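(* Let $G$ be a graph with $n$ vertices and $d\ge 0$ an integer. Then $\mathrm{mlt}(G)=d+1$ if and only if $d$ is the smallest dimension in which every generic $d$-dimensional framework $(G,p)$ is equivalent to an $(n-1)$-dimensional framework $(G,\tilde p)$ whose points $\tilde p(1),\dots,\tilde p(n)$ affinely span $\mathbb{R}^{n-1}$.
   Context: Let $G$ be a graph with vertex set $\{1,\dots,n\}$. Given data vectors $X_1,\dots,X_N\in\mathbb{R}^n$ with $S=\frac1N\sum_k X_kX_k^T$, the MLE of the Gaussian graphical model of $G$ exists if the minimization of $\operatorname{tr}(SK)-\log\det K$ over positive definite symmetric $n\times n$ matrices $K$ with $K_{ij}=0$ whenever $i\ne j$ and $ij\notin E(G)$ attains its minimum. $\mathrm{mlt}(G)$ is the smallest $N$ such that, for i.i.d. samples $X_1,\dots,X_N$ from a distribution on $\mathbb{R}^n$ mutually absolutely continuous with respect to Lebesgue measure, the MLE exists almost surely. A $d$-dimensional framework $(G,p)$ assigns points $p(i)\in\mathbb{R}^d$ to the vertices; it is generic if its coordinates are algebraically independent over $\mathbb{Q}$. Two frameworks $(G,p)$ (in $\mathbb{R}^d$) and $(G,q)$ (in $\mathbb{R}^{d'}$) are equivalent if $\|p(i)-p(j)\|=\|q(i)-q(j)\|$ for every edge $ij$ of $G$. *)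

theory Defs
  imports "HOL-Probability.Probability" "HOL-Library.Poly_Mapping"
begin

text \<open>
  Vertices are the elements of a finite type \<open>'n\<close>, so the number of vertices is
  \<open>CARD('n)\<close>. A simple graph is given by its adjacency relation
  \<open>E :: ('n \<times> 'n) set\<close>, which the theorem assumes to be symmetric and irreflexive.
\<close>

definition pos_def :: "real^'n^'n \<Rightarrow> bool" where
  "pos_def K \<longleftrightarrow> transpose K = K \<and> (\<forall>x. x \<noteq> 0 \<longrightarrow> x \<bullet> (K *v x) > 0)"

definition model_matrices :: "('n::finite \<times> 'n) set \<Rightarrow> (real^'n^'n) set" where
  "model_matrices E = {K. pos_def K \<and> (\<forall>i j. i \<noteq> j \<and> (i, j) \<notin> E \<longrightarrow> K $ i $ j = 0)}"

definition sample_cov :: "nat \<Rightarrow> (nat \<Rightarrow> real^'n) \<Rightarrow> real^'n^'n" where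
  "sample_cov N X = (\<chi> i j. (\<Sum>k<N. X k $ i * X k $ j) / real N)"

definition mle_objective :: "real^'n^'n \<Rightarrow> real^'n^'n \<Rightarrow> real" where
  "mle_objective S K = trace (S ** K) - ln (det K)"

definition mle_exists :: "('n::finite \<times> 'n) set \<Rightarrow> nat \<Rightarrow> (nat \<Rightarrow> real^'n) \<Rightarrow> bool" where
  "mle_exists E N X \<longleftrightarrow>
     (\<exists>K\<in>model_matrices E. \<forall>K'\<in>model_matrices E.
        mle_objective (sample_cov N X) K \<le> mle_objective (sample_cov N X) K')"

definition lebesgue_equivalent_distribution :: "(real^'n) measure \<Rightarrow> bool" where
  "lebesgue_equivalent_distribution \<mu> \<longleftrightarrow>
     prob_space \<mu> \<and> sets \<mu> = sets borel \<and>
     absolutely_continuous lborel \<mu> \<and> absolutely_continuous \<mu> lborel"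

text \<open>
  The joint law of \<open>N\<close> i.i.d. samples from \<open>\<mu>\<close> is the \<open>N\<close>-fold product of \<open>\<mu>\<close>. The
  condition \<open>1 \<le> N\<close> is there because the sample covariance has the factor \<open>1 / N\<close>.
\<close>

definition mle_exists_almost_surely :: "('n::finite \<times> 'n) set \<Rightarrow> nat \<Rightarrow> bool" where
  "mle_exists_almost_surely E N \<longleftrightarrow>
     (\<forall>\<mu>. lebesgue_equivalent_distribution \<mu> \<longrightarrow>
        (AE X in (\<Pi>\<^sub>M k\<in>{..<N}. \<mu>). mle_exists E N X))"

definition mlt :: "('n::finite \<times> 'n) set \<Rightarrow> nat" where
  "mlt E = (LEAST N. 1 \<le> N \<and> mle_exists_almost_surely E N)"

text \<open>
  A polynomial over the rationals in variables from \<open>'v\<close> maps monomials (exponent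
  vectors \<open>'v \<Rightarrow>\<^sub>0 nat\<close>) to coefficients, with finite support.
\<close>

definition eval_poly :: "(('v \<Rightarrow>\<^sub>0 nat) \<Rightarrow>\<^sub>0 rat) \<Rightarrow> ('v \<Rightarrow> real) \<Rightarrow> real" where
  "eval_poly P x =
     (\<Sum>m\<in>Poly_Mapping.keys P. of_rat (Poly_Mapping.lookup P m) *
        (\<Prod>v\<in>Poly_Mapping.keys m. x v ^ Poly_Mapping.lookup m v))"

definition algebraically_independent_over_rat :: "'v set \<Rightarrow> ('v \<Rightarrow> real) \<Rightarrow> bool" where
  "algebraically_independent_over_rat I x \<longleftrightarrow>
     (\<forall>P :: ('v \<Rightarrow>\<^sub>0 nat) \<Rightarrow>\<^sub>0 rat.
        (\<forall>m\<in>Poly_Mapping.keys P. Poly_Mapping.keys m \<subseteq> I) \<and> eval_poly P x = 0 \<longrightarrow> P = 0)"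

text \<open>
  As the dimension \<open>d\<close> varies inside the theorem, a point of \<open>d\<close>-dimensional space is a
  function \<open>nat \<Rightarrow> real\<close> of which only the coordinates \<open>k < d\<close> are ever used.
\<close>

type_synonym 'n framework = "'n \<Rightarrow> nat \<Rightarrow> real"

definition generic_framework :: "nat \<Rightarrow> 'n framework \<Rightarrow> bool" where
  "generic_framework d p \<longleftrightarrow>
     algebraically_independent_over_rat (UNIV \<times> {..<d}) (\<lambda>(i, k). p i k)"

definition point_dist :: "nat \<Rightarrow> (nat \<Rightarrow> real) \<Rightarrow> (nat \<Rightarrow> real) \<Rightarrow> real" where
  "point_dist d x y = L2_set (\<lambda>k. x k - y k) {..<d}"

definition equivalent_frameworks ::
    "('n \<times> 'n) set \<Rightarrow> nat \<Rightarrow> 'n framework \<Rightarrow> nat \<Rightarrow> 'n framework \<Rightarrow> bool" where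
  "equivalent_frameworks E d p d' q \<longleftrightarrow>
     (\<forall>(i, j)\<in>E. point_dist d (p i) (p j) = point_dist d' (q i) (q j))"

definition affinely_spanning :: "nat \<Rightarrow> ('n::finite) framework \<Rightarrow> bool" where
  "affinely_spanning m q \<longleftrightarrow>
     (\<forall>x :: nat \<Rightarrow> real. \<exists>c :: 'n \<Rightarrow> real.
        (\<Sum>i\<in>UNIV. c i) = 1 \<and> (\<forall>k<m. x k = (\<Sum>i\<in>UNIV. c i * q i k)))"

definition generic_frameworks_lift :: "('n::finite \<times> 'n) set \<Rightarrow> nat \<Rightarrow> bool" where
  "generic_frameworks_lift E d \<longleftrightarrow>
     (\<forall>p. generic_framework d p \<longrightarrow>
        (\<exists>q. equivalent_frameworks E d p (CARD('n) - 1) q \<and>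
             affinely_spanning (CARD('n) - 1) q))"

end

(*
  Call a set of vectors stressed if some nonzero positive semidefinite matrix with the sparsity
  pattern of the graph annihilates all of them. By compactness of the sublevel sets of the
  likelihood, the MLE exists iff the samples are not stressed; by separating the cone of positive
  definite matrices from an affine space, a framework lifts to a spanning one iff its coordinate
  vectors together with the all-ones vector are not stressed. Scaling the vertices to make one of
  the N = d + 1 sample vectors the all-ones vector turns the former condition into the latter.

  It remains to compare "almost all" with "all generic": almost all configurations are generic, and
  conversely the configurations near a generic stressed one are stressed. The second claim replaces
  an appeal to Tarski-Seidenberg: along any sequence of configurations converging to a generic
  one, the entries of a Gram factor of the stress can be continued, one by one and keeping all their
  polynomial relations. Transcendental entries are kept constant, and algebraic ones follow a simple
  root of their minimal polynomial.
*)
theory Submission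
  imports Defs
begin

subsection \<open>Positive semidefinite matrices and stresses\<close>

text \<open>Semidefiniteness is an inequality, and the entries of a stress may be algebraically
  arbitrary; both stand in the way of carrying a stress over to nearby configurations. A Gram factor
  removes the first difficulty, since a sum of squares is semidefinite whatever the entries of the
  factor. What has to persist is then a list of polynomial equations (zero pattern and kernel) and
  one nonzero entry, which survives by convergence. Genericity provides the start: a rational
  polynomial that vanishes at a generic point vanishes identically, so the coordinates can follow
  any sequence. Arguing by contradiction with sequences yields a whole neighbourhood, and thus an
  event of positive probability.

  The all-ones vector stands for translations on the framework side; on the sample side it takes up
  one sample, whence N = d + 1. Since \<open>mlt\<close> is a least number, some N must work at all:
  d = n does, because then the coordinate vectors of a generic framework span the space.\<close>

definition psd :: "real^'n^'n \<Rightarrow> bool" where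
  "psd K \<longleftrightarrow> transpose K = K \<and> (\<forall>x. 0 \<le> x \<bullet> (K *v x))"

text \<open>If \<open>V\<close> consists of the all-ones vector and the coordinate vectors of a
  framework, such an \<Omega> is a positive semidefinite equilibrium stress matrix. Keeping
  \<open>V\<close> arbitrary puts samples and frameworks under one notion.\<close>

definition stressed :: "('n::finite \<times> 'n) set \<Rightarrow> (real^'n) set \<Rightarrow> bool" where
  "stressed E V \<longleftrightarrow> (\<exists>\<Omega> :: real^'n^'n. \<Omega> \<noteq> 0 \<and> psd \<Omega> \<and>
     (\<forall>i j. i \<noteq> j \<and> (i, j) \<notin> E \<longrightarrow> \<Omega> $ i $ j = 0) \<and> (\<forall>v\<in>V. \<Omega> *v v = 0))"

lemma symmetric_nth: "transpose K = K \<Longrightarrow> K $ i $ j = K $ j $ i"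
  for K :: "real^'n^'n"
  by (metis transpose_def vec_lambda_beta)

lemma symmetric_inner: "transpose K = K \<Longrightarrow> x \<bullet> (K *v y) = y \<bullet> (K *v x)"
  for K :: "real^'n^'n"
  by (metis dot_lmul_matrix inner_commute vector_transpose_matrix)

lemma quadratic_form_sum: "x \<bullet> (K *v y) = (\<Sum>i\<in>UNIV. \<Sum>j\<in>UNIV. K $ i $ j * x $ i * y $ j)"
  for K :: "real^'n^'n"
  by (simp add: inner_vec_def matrix_vector_mult_def sum_distrib_left algebra_simps)

text \<open>The form at \<open>x + t *\<^sub>R y\<close> is a nonnegative quadratic polynomial in
  \<open>t\<close>. If its leading coefficient vanishes it is affine, hence constant; otherwise its
  value at the minimiser \<open>- b / a\<close> gives the inequality.\<close>

lemma psd_cauchy_schwarz: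
  assumes "psd K"
  shows "(x \<bullet> (K *v y))\<^sup>2 \<le> (x \<bullet> (K *v x)) * (y \<bullet> (K *v y))"
proof -
  define a where "a = y \<bullet> (K *v y)"
  define b where "b = x \<bullet> (K *v y)"
  define c where "c = x \<bullet> (K *v x)"
  have sym: "y \<bullet> (K *v x) = b"
    using assms symmetric_inner unfolding psd_def b_def by metis
  have q: "0 \<le> c + 2 * t * b + t\<^sup>2 * a" for t
  proof -
    have "0 \<le> (x + t *\<^sub>R y) \<bullet> (K *v (x + t *\<^sub>R y))"
      using assms by (simp add: psd_def)
    also have "\<dots> = c + 2 * t * b + t\<^sup>2 * a"
      using sym by (simp add: a_def b_def c_def matrix_vector_right_distrib inner_add_left
          inner_add_right matrix_vector_mult_scaleR power2_eq_square algebra_simps)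
    finally show ?thesis .
  qed
  have a0: "0 \<le> a" and c0: "0 \<le> c" using assms by (auto simp: psd_def a_def c_def)
  show ?thesis
  proof (cases "a = 0")
    case True
    have "b = 0"
    proof (rule ccontr)
      assume "b \<noteq> 0"
      then show False using q[of "- (c + 1) / (2 * b)"] True by (simp add: field_simps)
    qed
    then show ?thesis using True by (simp add: a_def b_def)
  next
    case False
    then have "a > 0" using a0 by simp
    have "0 \<le> c - b\<^sup>2 / a"
      using q[of "- b / a"] \<open>a > 0\<close> by (simp add: field_simps power2_eq_square)
    then show ?thesis using \<open>a > 0\<close> by (simp add: a_def b_def c_def field_simps)
  qed
qed

text \<open>Cauchy-Schwarz for \<open>K *v x\<close> and \<open>x\<close>. This turns vanishing
  energy into a linear equation.\<close>

lemma psd_kernel: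
  assumes "psd K" "x \<bullet> (K *v x) = 0"
  shows "K *v x = 0"
proof -
  have "((K *v x) \<bullet> (K *v x))\<^sup>2 \<le> 0"
    using psd_cauchy_schwarz[OF assms(1), of "K *v x" x] assms(2) by simp
  then show ?thesis by simp
qed

lemma outer_product_quadratic: "x \<bullet> ((\<chi> a b. u $ a * u $ b) *v x) = (u \<bullet> x)\<^sup>2"
  for x u :: "real^'n"
  by (simp add: inner_vec_def matrix_vector_mult_def power2_eq_square sum_product
      sum_distrib_left algebra_simps)

lemma psd_outer_product: "psd (\<chi> a b. u $ a * u $ b)"
  by (simp add: psd_def outer_product_quadratic transpose_def vec_eq_iff mult.commute)

lemma sum_matrix_vector_mult: "(\<Sum>k\<in>A. f k) *v x = (\<Sum>k\<in>A. f k *v x)"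
  for f :: "'k \<Rightarrow> real^'n^'m"
  by (induction A rule: infinite_finite_induct) (auto simp: matrix_vector_mult_add_rdistrib)

lemma psd_sum:
  assumes "\<And>k. k \<in> A \<Longrightarrow> psd (f k)"
  shows "psd (\<Sum>k\<in>A. f k)"
  using assms
proof (induction A rule: infinite_finite_induct)
  case (insert k A)
  then have "psd (f k)" "psd (sum f A)" by auto
  then have "psd (f k + sum f A)"
    by (auto simp: psd_def matrix_vector_mult_add_rdistrib inner_add_right
        transpose_def vec_eq_iff)
  then show ?case using insert by simp
qed (auto simp: psd_def transpose_def vec_eq_iff)

section \<open>Gram matrices and Cholesky factors\<close>

definition gram :: "('k \<Rightarrow> real^'n) \<Rightarrow> 'k set \<Rightarrow> real^'n^'n" where
  "gram u A = (\<chi> a b. \<Sum>k\<in>A. u k $ a * u k $ b)"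

lemma gram_eq_sum: "gram u A = (\<Sum>k\<in>A. (\<chi> a b. u k $ a * u k $ b))"
  by (simp add: gram_def vec_eq_iff)

lemma psd_gram: "psd (gram u A)"
  unfolding gram_eq_sum by (intro psd_sum psd_outer_product)

lemma gram_quadratic: "x \<bullet> (gram u A *v x) = (\<Sum>k\<in>A. (u k \<bullet> x)\<^sup>2)"
  by (simp add: gram_eq_sum sum_matrix_vector_mult inner_sum_right outer_product_quadratic)

lemma axis_quadratic: "axis i 1 \<bullet> (K *v axis j 1) = K $ i $ j" for K :: "real^'n^'n"
  by (simp add: inner_axis' matrix_vector_mult_basis column_def)

text \<open>One step of the Cholesky decomposition clears a row and a column and keeps the
  matrix positive semidefinite.\<close>

lemma psd_cholesky_step:
  assumes "psd K" "K $ i $ i > 0"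
  shows "psd (K - (\<chi> a b. K $ i $ a * K $ i $ b / K $ i $ i))"
proof -
  define R where "R = (\<chi> a b. K $ i $ a * K $ i $ b / K $ i $ i)"
  have 1: "x \<bullet> (R *v x) = (axis i 1 \<bullet> (K *v x))\<^sup>2 / K $ i $ i" for x
  proof -
    have "R *v x = ((axis i 1 \<bullet> (K *v x)) / K $ i $ i) *\<^sub>R K $ i"
      by (simp add: R_def vec_eq_iff matrix_vector_mult_def inner_axis' sum_distrib_left
          sum_divide_distrib algebra_simps)
    moreover have "x \<bullet> K $ i = axis i 1 \<bullet> (K *v x)"
      by (simp add: inner_axis' matrix_vector_mult_def) (simp add: inner_vec_def mult.commute)
    ultimately show ?thesis by (simp add: power2_eq_square)
  qed
  have 2: "x \<bullet> (R *v x) \<le> x \<bullet> (K *v x)" for x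
    using psd_cauchy_schwarz[OF assms(1), of "axis i 1" x] assms(2)
    by (simp add: 1 axis_quadratic field_simps)
  have "transpose (K - R) = K - R"
    using assms(1) by (auto simp: psd_def R_def transpose_def vec_eq_iff)
  then show ?thesis
    using 2 by (auto simp: psd_def R_def[symmetric] matrix_vector_mult_diff_rdistrib inner_diff_right)
qed

lemma psd_diag_zero:
  assumes "psd K" "K $ i $ i = 0"
  shows "K $ i $ j = 0" "K $ j $ i = 0"
proof -
  have "K *v axis i 1 = 0"
    using assms by (intro psd_kernel) (auto simp: axis_quadratic)
  then show "K $ j $ i = 0" by (simp add: matrix_vector_mult_basis column_def vec_eq_iff)
  then show "K $ i $ j = 0" using assms(1) symmetric_nth unfolding psd_def by metis
qed

lemma psd_diag_nonneg: "psd K \<Longrightarrow> 0 \<le> K $ i $ i"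
  using axis_quadratic[of i K i] unfolding psd_def by metis

text \<open>Induction on the number of nonzero diagonal entries: a Cholesky step removes at least
  one and creates none. The second conjunct keeps the slot of the removed index free, and later
  makes one coordinate of a realization vanish.\<close>

lemma psd_eq_gram:
  fixes K :: "real^'n^'n"
  assumes "psd K"
  shows "\<exists>u. K = gram u (UNIV :: 'n set) \<and> (\<forall>i. K $ i $ i = 0 \<longrightarrow> u i = 0)"
  using assms
proof (induction "card {i. K $ i $ i \<noteq> 0}" arbitrary: K rule: less_induct)
  case less
  show ?case
  proof (cases "\<exists>i. K $ i $ i \<noteq> 0")
    case False
    then have "K $ a $ b = 0" for a b using psd_diag_zero(1)[OF less.prems, of a b] by blast
    then have "K = 0" by (simp add: vec_eq_iff)
    then show ?thesis by (intro exI[of _ "\<lambda>_. 0"]) (auto simp: gram_def vec_eq_iff)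
  next
    case True
    then obtain i where i: "K $ i $ i \<noteq> 0" by auto
    then have pos: "K $ i $ i > 0" using psd_diag_nonneg[OF less.prems, of i] by simp
    define K' where "K' = K - (\<chi> a b. K $ i $ a * K $ i $ b / K $ i $ i)"
    have psd': "psd K'" unfolding K'_def by (rule psd_cholesky_step[OF less.prems pos])
    have zi: "K' $ i $ i = 0" using i by (simp add: K'_def)
    have z: "K' $ j $ j = 0" if "K $ j $ j = 0" for j
      using that psd_diag_zero[OF less.prems that] by (simp add: K'_def)
    have "{j. K' $ j $ j \<noteq> 0} \<subset> {j. K $ j $ j \<noteq> 0}" using z zi i by blast
    then have "card {j. K' $ j $ j \<noteq> 0} < card {j. K $ j $ j \<noteq> 0}"
      by (intro psubset_card_mono) auto
    from less.hyps[OF this psd'] obtain u where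
      u: "K' = gram u UNIV" "\<forall>j. K' $ j $ j = 0 \<longrightarrow> u j = 0" by blast
    \<comment> \<open>\<open>u i\<close> is zero because \<open>K' $ i $ i\<close> is, so the
      removed rank-one term can take this slot.\<close>
    define u' where "u' = u(i := (1 / sqrt (K $ i $ i)) *\<^sub>R (K $ i))"
    have "K $ a $ b = (\<Sum>k\<in>UNIV. u' k $ a * u' k $ b)" for a b
    proof -
      have "(\<Sum>k\<in>UNIV. u' k $ a * u' k $ b)
          = u' i $ a * u' i $ b + (\<Sum>k\<in>UNIV - {i}. u k $ a * u k $ b)"
        by (subst sum.remove[of _ i]) (auto simp: u'_def intro!: sum.cong)
      also have "(\<Sum>k\<in>UNIV - {i}. u k $ a * u k $ b) = K' $ a $ b"
        unfolding u(1) gram_def using u(2) zi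
        by (simp add: sum.remove[of UNIV i])
      also have "u' i $ a * u' i $ b = K $ i $ a * K $ i $ b / K $ i $ i"
        using pos by (simp add: u'_def)
      finally show ?thesis by (simp add: K'_def)
    qed
    then have "K = gram u' UNIV" by (simp add: gram_def vec_eq_iff)
    moreover have "u' j = 0" if "K $ j $ j = 0" for j
      using that i u(2) z by (auto simp: u'_def)
    ultimately show ?thesis by blast
  qed
qed

text \<open>With D = diag(x), the congruence D \<Omega> D stays semidefinite and nonzero with the
  zeros of the pattern, and it annihilates \<open>w\<close> when \<Omega> annihilates D w. The
  factors may have any sign.\<close>

lemma stressed_rescale:
  fixes x :: "'n::finite \<Rightarrow> real"
  assumes "stressed E V" "\<And>i. x i \<noteq> 0" "\<And>w. w \<in> W \<Longrightarrow> (\<chi> i. x i * w $ i) \<in> V"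
  shows "stressed E W"
proof -
  obtain \<Omega> :: "real^'n^'n" where \<Omega>: "\<Omega> \<noteq> 0" "psd \<Omega>"
      "\<forall>i j. i \<noteq> j \<and> (i, j) \<notin> E \<longrightarrow> \<Omega> $ i $ j = 0" "\<forall>v\<in>V. \<Omega> *v v = 0"
    using assms(1) unfolding stressed_def by blast
  define \<Omega>' :: "real^'n^'n" where "\<Omega>' = (\<chi> i j. x i * x j * \<Omega> $ i $ j)"
  have mul: "(\<Omega>' *v w) $ i = x i * (\<Omega> *v (\<chi> i. x i * w $ i)) $ i" for w i
    by (simp add: \<Omega>'_def matrix_vector_mult_def sum_distrib_left algebra_simps)
  have "w \<bullet> (\<Omega>' *v w) = (\<chi> i. x i * w $ i) \<bullet> (\<Omega> *v (\<chi> i. x i * w $ i))" for w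
    by (simp add: inner_vec_def mul algebra_simps)
  moreover have "transpose \<Omega>' = \<Omega>'"
    using \<Omega>(2) by (auto simp: psd_def \<Omega>'_def transpose_def vec_eq_iff)
  ultimately have "psd \<Omega>'" using \<Omega>(2) by (simp add: psd_def)
  moreover have "\<Omega>' \<noteq> 0" using \<Omega>(1) assms(2) by (auto simp: \<Omega>'_def vec_eq_iff)
  moreover have "\<Omega>' *v w = 0" if "w \<in> W" for w
    using \<Omega>(4) assms(3)[OF that] by (simp add: vec_eq_iff mul)
  moreover have "\<forall>i j. i \<noteq> j \<and> (i, j) \<notin> E \<longrightarrow> \<Omega>' $ i $ j = 0"
    using \<Omega>(3) by (simp add: \<Omega>'_def)
  ultimately show ?thesis unfolding stressed_def by blast
qed

subsection \<open>Lifting a framework\<close>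

lemma minus_matrix_vector_mult: "(- A) *v x = - (A *v x)" for A :: "real^'n^'m"
  by (simp add: matrix_vector_mult_def vec_eq_iff sum_negf)

lemma point_dist_eq_iff:
  "point_dist d x y = point_dist d' x' y' \<longleftrightarrow>
     (\<Sum>k<d. (x k - y k)\<^sup>2) = (\<Sum>k<d'. (x' k - y' k)\<^sup>2)"
  by (simp add: point_dist_def L2_set_def)

text \<open>Row and column sums of \<Omega> vanish, so only the cross terms of the squares survive.
  The left side involves distances only, and just edge lengths if \<Omega> has the pattern of the
  graph; this makes equivalent frameworks comparable.\<close>

lemma stress_energy:
  fixes \<Omega> :: "real^'n^'n"
  assumes "transpose \<Omega> = \<Omega>" "\<Omega> *v 1 = 0"
  shows "(\<Sum>i\<in>UNIV. \<Sum>j\<in>UNIV. \<Omega> $ i $ j * (\<Sum>k<m. (y i k - y j k)\<^sup>2)) =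
    - 2 * (\<Sum>k<m. (\<chi> i. y i k) \<bullet> (\<Omega> *v (\<chi> i. y i k)))"
proof -
  have row: "(\<Sum>j\<in>UNIV. \<Omega> $ i $ j) = 0" for i
    using assms(2) by (simp add: matrix_vector_mult_def vec_eq_iff)
  have col: "(\<Sum>i\<in>UNIV. \<Omega> $ i $ j) = 0" for j
    using row[of j] symmetric_nth[OF assms(1), of j] by simp
  have "(\<Sum>i\<in>UNIV. \<Sum>j\<in>UNIV. \<Omega> $ i $ j * (z i - z j)\<^sup>2) =
      - 2 * ((\<chi> i. z i) \<bullet> (\<Omega> *v (\<chi> i. z i)))" for z
  proof -
    have "(\<Sum>i\<in>UNIV. \<Sum>j\<in>UNIV. \<Omega> $ i $ j * (z i - z j)\<^sup>2) =
        (\<Sum>i\<in>UNIV. \<Sum>j\<in>UNIV. \<Omega> $ i $ j * (z i)\<^sup>2) + (\<Sum>i\<in>UNIV. \<Sum>j\<in>UNIV. \<Omega> $ i $ j * (z j)\<^sup>2)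
        - 2 * (\<Sum>i\<in>UNIV. \<Sum>j\<in>UNIV. \<Omega> $ i $ j * z i * z j)"
      by (simp add: power2_diff sum.distrib sum_subtractf sum_distrib_left algebra_simps)
    also have "(\<Sum>i\<in>UNIV. \<Sum>j\<in>UNIV. \<Omega> $ i $ j * (z i)\<^sup>2) = 0"
      using row by (simp flip: sum_distrib_right)
    also have "(\<Sum>i\<in>UNIV. \<Sum>j\<in>UNIV. \<Omega> $ i $ j * (z j)\<^sup>2) = 0"
      using col by (subst sum.swap) (simp flip: sum_distrib_right)
    finally show ?thesis by (simp add: quadratic_form_sum)
  qed
  note z = this
  have "(\<Sum>i\<in>UNIV. \<Sum>j\<in>UNIV. \<Omega> $ i $ j * (\<Sum>k<m. (y i k - y j k)\<^sup>2)) =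
      (\<Sum>i\<in>UNIV. \<Sum>j\<in>UNIV. \<Sum>k<m. \<Omega> $ i $ j * (y i k - y j k)\<^sup>2)"
    by (simp add: sum_distrib_left)
  also have "\<dots> = (\<Sum>i\<in>UNIV. \<Sum>k<m. \<Sum>j\<in>UNIV. \<Omega> $ i $ j * (y i k - y j k)\<^sup>2)"
    by (intro sum.cong refl sum.swap)
  also have "\<dots> = (\<Sum>k<m. \<Sum>i\<in>UNIV. \<Sum>j\<in>UNIV. \<Omega> $ i $ j * (y i k - y j k)\<^sup>2)"
    by (rule sum.swap)
  also have "\<dots> = (\<Sum>k<m. - 2 * ((\<chi> i. y i k) \<bullet> (\<Omega> *v (\<chi> i. y i k))))"
    by (intro sum.cong refl z)
  finally show ?thesis by (simp add: sum_distrib_left)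
qed

text \<open>The coefficient sum and the combinations of the n - 1 coordinates together form an
  endomorphism \<open>F\<close> of n-dimensional space. Affine spanning makes it surjective, hence
  injective.\<close>

lemma affinely_spanning_imp_independent:
  fixes q :: "'n::finite framework" and c :: "real^'n"
  assumes span: "affinely_spanning (CARD('n) - 1) q"
    and c0: "(\<Sum>j\<in>UNIV. c $ j) = 0" and cq: "\<And>k. k < CARD('n) - 1 \<Longrightarrow> (\<Sum>j\<in>UNIV. c $ j * q j k) = 0"
  shows "c = 0"
proof -
  obtain h :: "'n \<Rightarrow> nat" where h: "bij_betw h UNIV {..<CARD('n)}"
    using ex_bij_betw_finite_nat[of "UNIV :: 'n set"] by (auto simp: atLeast0LessThan)
  define F :: "real^'n \<Rightarrow> real^'n" where
    "F c = (\<chi> a. if h a = CARD('n) - 1 then (\<Sum>j\<in>UNIV. c $ j) else (\<Sum>j\<in>UNIV. c $ j * q j (h a)))" for c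
  have lin: "linear F"
    by (rule linearI)
      (auto simp: F_def vec_eq_iff sum.distrib sum_distrib_left algebra_simps)
  have "surj F"
    unfolding surj_def
  proof
    fix y :: "real^'n"
    define l where "l = inv_into UNIV h (CARD('n) - 1)"
    have hinv: "inv_into UNIV h (h a) = a" for a
      using h by (simp add: bij_betw_def)
    obtain c0 where c0: "(\<Sum>i\<in>UNIV. c0 i) = 1"
        "\<And>k. k < CARD('n) - 1 \<Longrightarrow> 0 = (\<Sum>i\<in>UNIV. c0 i * q i k)"
      using span[unfolded affinely_spanning_def, rule_format, of "\<lambda>_. 0"] by auto
    obtain c1 where c1: "(\<Sum>i\<in>UNIV. c1 i) = 1"
        "\<And>k. k < CARD('n) - 1 \<Longrightarrow> y $ (inv_into UNIV h k) = (\<Sum>i\<in>UNIV. c1 i * q i k)"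
      using span[unfolded affinely_spanning_def, rule_format, of "\<lambda>k. y $ (inv_into UNIV h k)"] by auto
    \<comment> \<open>\<open>c1 - c0\<close> has coefficient sum 0 and represents the prescribed
      coordinates; since \<open>c0\<close> represents the origin with sum 1, adding a multiple of it
      corrects the sum alone.\<close>
    define c :: "real^'n" where "c = (\<chi> i. c1 i - c0 i + y $ l * c0 i)"
    have "F c $ a = y $ a" for a
    proof (cases "h a = CARD('n) - 1")
      case True
      then have "a = l" using hinv[of a] by (simp add: l_def)
      then show ?thesis using True c0(1) c1(1)
        by (simp add: F_def c_def sum.distrib sum_subtractf flip: sum_distrib_left)
    next
      case False
      moreover have "h a < CARD('n)" using h by (auto simp: bij_betw_def)
      ultimately have ha: "h a < CARD('n) - 1" by simp
      have "F c $ a = (\<Sum>j\<in>UNIV. c1 j * q j (h a)) - (\<Sum>j\<in>UNIV. c0 j * q j (h a))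
          + y $ l * (\<Sum>j\<in>UNIV. c0 j * q j (h a))"
        using False by (simp add: F_def c_def algebra_simps sum.distrib sum_subtractf sum_distrib_left)
      then show ?thesis using c0(2)[OF ha] c1(2)[OF ha] hinv by simp
    qed
    then show "\<exists>x. y = F x" by (metis vec_eq_iff)
  qed
  then have "inj F" using linear_surjective_imp_injective[OF lin] by simp
  moreover have "F c = 0"
  proof -
    have "h a < CARD('n)" for a using h by (auto simp: bij_betw_def)
    then show ?thesis using c0 cq
      by (auto simp: F_def vec_eq_iff) (metis Suc_pred less_SucE zero_less_card_finite)
  qed
  ultimately show ?thesis using linear_injective_0[OF lin] by blast
qed

lemma spanning_lift_imp_not_stressed:
  fixes p :: "'n::finite framework"
  assumes "equivalent_frameworks E d p (CARD('n) - 1) q" "affinely_spanning (CARD('n) - 1) q"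
  shows "\<not> stressed E (insert 1 ((\<lambda>k. \<chi> i. p i k) ` {..<d}))"
proof
  assume "stressed E (insert 1 ((\<lambda>k. \<chi> i. p i k) ` {..<d}))"
  then obtain \<Omega> :: "real^'n^'n" where \<Omega>: "\<Omega> \<noteq> 0" "psd \<Omega>"
      "\<And>i j. i \<noteq> j \<Longrightarrow> (i, j) \<notin> E \<Longrightarrow> \<Omega> $ i $ j = 0"
      "\<Omega> *v 1 = 0" "\<And>k. k < d \<Longrightarrow> \<Omega> *v (\<chi> i. p i k) = 0"
    unfolding stressed_def by auto
  have sym: "transpose \<Omega> = \<Omega>" using \<Omega>(2) by (simp add: psd_def)
  have "\<Omega> $ i $ j * (\<Sum>k<CARD('n) - 1. (q i k - q j k)\<^sup>2) = \<Omega> $ i $ j * (\<Sum>k<d. (p i k - p j k)\<^sup>2)"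
    for i j
    using assms(1) \<Omega>(3)[of i j] unfolding equivalent_frameworks_def point_dist_eq_iff
    by (cases "i = j"; cases "(i, j) \<in> E") auto
  then have "(\<Sum>i\<in>UNIV. \<Sum>j\<in>UNIV. \<Omega> $ i $ j * (\<Sum>k<CARD('n) - 1. (q i k - q j k)\<^sup>2)) =
      (\<Sum>i\<in>UNIV. \<Sum>j\<in>UNIV. \<Omega> $ i $ j * (\<Sum>k<d. (p i k - p j k)\<^sup>2))"
    by (intro sum.cong refl)
  \<comment> \<open>The two energies agree, and that of \<open>p\<close> is zero because its
    coordinate vectors lie in the kernel.\<close>
  then have "(\<Sum>k<CARD('n) - 1. (\<chi> i. q i k) \<bullet> (\<Omega> *v (\<chi> i. q i k))) = 0"
    unfolding stress_energy[OF sym \<Omega>(4)] using \<Omega>(5) by simp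
  then have "(\<chi> i. q i k) \<bullet> (\<Omega> *v (\<chi> i. q i k)) = 0" if "k < CARD('n) - 1" for k
    using that \<Omega>(2) by (subst (asm) sum_nonneg_eq_0_iff) (auto simp: psd_def)
  then have "\<Omega> *v (\<chi> i. q i k) = 0" if "k < CARD('n) - 1" for k
    using that psd_kernel[OF \<Omega>(2)] by blast
  \<comment> \<open>Each row of \<Omega> is an affine dependence between the points of
    \<open>q\<close>.\<close>
  then have "\<Omega> $ i = 0" for i
    using \<Omega>(4) by (intro affinely_spanning_imp_independent[OF assms(2)])
      (auto simp: matrix_vector_mult_def vec_eq_iff)
  then show False using \<Omega>(1) by (simp add: vec_eq_iff)
qed

section \<open>Positive definite completions of squared edge lengths\<close>

lemma pos_def_convex: "convex {A. pos_def A}"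
proof (rule convexI)
  fix A B :: "real^'n^'n" and u v :: real
  assume AB: "A \<in> {A. pos_def A}" "B \<in> {A. pos_def A}" and uv: "0 \<le> u" "0 \<le> v" "u + v = 1"
  have "0 < x \<bullet> ((u *\<^sub>R A + v *\<^sub>R B) *v x)" if "x \<noteq> 0" for x
  proof -
    have "0 < x \<bullet> (A *v x)" "0 < x \<bullet> (B *v x)" using AB that by (auto simp: pos_def_def)
    then have "0 < u * (x \<bullet> (A *v x)) + v * (x \<bullet> (B *v x))"
      using uv by (cases "u = 0") (auto intro!: add_pos_nonneg)
    then show ?thesis
      by (simp add: matrix_vector_mult_add_rdistrib inner_add_right flip: scaleR_matrix_vector_assoc)
  qed
  moreover have "transpose (u *\<^sub>R A + v *\<^sub>R B) = u *\<^sub>R A + v *\<^sub>R B"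
    using AB symmetric_nth by (auto simp: pos_def_def transpose_def vec_eq_iff)
  ultimately show "u *\<^sub>R A + v *\<^sub>R B \<in> {A. pos_def A}" by (simp add: pos_def_def)
qed

lemma pos_def_add_psd: "pos_def A \<Longrightarrow> psd B \<Longrightarrow> pos_def (A + B)"
  by (auto simp: pos_def_def psd_def matrix_vector_mult_add_rdistrib inner_add_right
      transpose_def vec_eq_iff intro!: add_pos_nonneg)

lemma pos_def_scaleR: "pos_def A \<Longrightarrow> c > 0 \<Longrightarrow> pos_def (c *\<^sub>R A)"
  by (auto simp: pos_def_def transpose_def vec_eq_iff simp flip: scaleR_matrix_vector_assoc)

lemma psd_scaleR: "psd A \<Longrightarrow> c \<ge> 0 \<Longrightarrow> psd (c *\<^sub>R A)"
  by (auto simp: psd_def transpose_def vec_eq_iff simp flip: scaleR_matrix_vector_assoc)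

lemma pos_def_mat_1: "pos_def (mat 1)"
  by (simp add: pos_def_def)

lemma pos_def_imp_psd: "pos_def A \<Longrightarrow> psd A"
  unfolding pos_def_def psd_def by (metis inner_zero_left order_le_less)

lemma inner_outer_product: "A \<bullet> (\<chi> a b. x $ a * x $ b) = x \<bullet> (A *v x)"
  for A :: "real^'n^'n"
  by (simp add: inner_vec_def inner_real_def matrix_vector_mult_def sum_distrib_left algebra_simps)

lemma bounded_below_imp_slope_nonneg:
  assumes "\<And>t :: real. 0 \<le> t \<Longrightarrow> b \<le> c + t * s"
  shows "0 \<le> s"
proof (rule ccontr)
  assume "\<not> 0 \<le> s"
  \<comment> \<open>This step length moves the value to \<open>c - |c - b| - 1\<close>, which is
    below \<open>b\<close>.\<close>
  moreover have "0 \<le> (\<bar>c - b\<bar> + 1) / - s" using calculation by (intro divide_nonneg_pos) auto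
  moreover have "(\<bar>c - b\<bar> + 1) / - s * s = - (\<bar>c - b\<bar> + 1)" using calculation(1) by simp
  ultimately show False using assms[of "(\<bar>c - b\<bar> + 1) / - s"] by linarith
qed

text \<open>Separates the positive definite matrices from the affine space of matrices that
  induce the given squared edge lengths. The separating functional is a stress.\<close>

lemma not_stressed_imp_pos_def_completion:
  fixes p :: "'n::finite framework"
  assumes "sym E" and ns: "\<not> stressed E (insert 1 ((\<lambda>k. \<chi> i. p i k) ` {..<d}))"
  shows "\<exists>A. pos_def A \<and>
    (\<forall>(i, j)\<in>E. A $ i $ i + A $ j $ j - 2 * A $ i $ j = (\<Sum>k<d. (p i k - p j k)\<^sup>2))"
proof (rule ccontr)
  assume neg: "\<not> ?thesis"
  define G :: "real^'n^'n" where "G = gram (\<lambda>k. \<chi> i. p i k) {..<d}"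
  \<comment> \<open>Symmetrized so as to act on all square matrices, where the separation takes
    place; antisymmetric matrices lie in its kernel, which will force \<open>a\<close> to be
    symmetric.\<close>
  define L where "L B = (\<lambda>(i, j). B $ i $ i + B $ j $ j - B $ i $ j - B $ j $ i)" for B :: "real^'n^'n"
  define T where "T = {B. \<forall>e\<in>E. L B e = L G e}"
  have LG: "L G (i, j) = (\<Sum>k<d. (p i k - p j k)\<^sup>2)" for i j
    by (simp add: L_def G_def gram_def power2_eq_square sum.distrib sum_subtractf
        sum_distrib_left algebra_simps)
  have Ladd: "L (B + t *\<^sub>R C) e = L B e + t * L C e" for B C t e
    by (simp add: L_def split: prod.splits) (simp add: algebra_simps)
  have "convex T"
  proof (rule convexI)
    fix A B :: "real^'n^'n" and u v :: real
    assume "A \<in> T" "B \<in> T" and uv: "0 \<le> u" "0 \<le> v" "u + v = 1"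
    moreover have "L (u *\<^sub>R A + v *\<^sub>R B) e = u * L A e + v * L B e" for e
      by (simp add: L_def split: prod.splits) (simp add: algebra_simps)
    ultimately show "u *\<^sub>R A + v *\<^sub>R B \<in> T" 
      by (simp add: T_def flip: distrib_right)
  qed
  moreover have GT: "G \<in> T" by (simp add: T_def)
  moreover have "{A. pos_def A} \<inter> T = {}"
  proof -
    have False if "pos_def A" "A \<in> T" for A
    proof -
      have "L A (i, j) = A $ i $ i + A $ j $ j - 2 * A $ i $ j" for i j
        using that(1) symmetric_nth[of A i j] by (simp add: L_def pos_def_def)
      then show False using neg that LG unfolding T_def by fastforce
    qed
    then show ?thesis by blast
  qed
  moreover have "{A :: real^'n^'n. pos_def A} \<noteq> {}" using pos_def_mat_1 by blast
  ultimately obtain a b where ab: "a \<noteq> 0" "\<And>A. pos_def A \<Longrightarrow> a \<bullet> A \<le> b" "\<And>B. B \<in> T \<Longrightarrow> b \<le> a \<bullet> B"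
    using separating_hyperplane_sets[OF pos_def_convex, of T] by blast
  \<comment> \<open>\<open>T\<close> contains a whole line in direction \<open>Z\<close>, and a
    linear functional bounded below on a line is constant on it.\<close>
  have orth: "a \<bullet> Z = 0" if "\<And>e. e \<in> E \<Longrightarrow> L Z e = 0" for Z
  proof -
    have bt: "b \<le> a \<bullet> G + t * (a \<bullet> Z)" for t
      using ab(3)[of "G + t *\<^sub>R Z"] that by (simp add: T_def Ladd inner_add_right)
    have "0 \<le> a \<bullet> Z" by (rule bounded_below_imp_slope_nonneg) (rule bt)
    moreover have "0 \<le> - (a \<bullet> Z)"
      by (rule bounded_below_imp_slope_nonneg[of b "a \<bullet> G"]) (use bt[of "- t" for t] in simp)
    ultimately show ?thesis by simp
  qed
  \<comment> \<open>The functional is bounded above on the positive definite cone, so its negative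
    is the semidefinite one.\<close>
  define \<Omega> where "\<Omega> = - a"
  have "a \<bullet> (axis i (axis j 1) - axis j (axis i 1)) = 0" for i j
    by (rule orth) (auto simp: L_def axis_def)
  then have sym: "a $ i $ j = a $ j $ i" for i j
    by (simp add: inner_diff_right inner_axis)
  have pat: "a $ i $ j = 0" if "i \<noteq> j" "(i, j) \<notin> E" for i j
  proof -
    have "a \<bullet> axis i (axis j 1) = 0"
      by (rule orth) (use that \<open>sym E\<close> in \<open>auto simp: L_def axis_def sym_def\<close>)
    then show ?thesis by (simp add: inner_axis)
  qed
  \<comment> \<open>Here \<open>axis i 1\<close> is the matrix with ones in row \<open>i\<close> and
    zeros elsewhere. As \<open>L\<close> sends it to zero, the row sums of \<open>a\<close>
    vanish.\<close>
  have "a \<bullet> axis i 1 = 0" for i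
    by (rule orth) (auto simp: L_def axis_def)
  then have ker1: "a *v 1 = 0"
    by (simp add: vec_eq_iff inner_axis matrix_vector_mult_def) (simp add: inner_vec_def)
  have neg_form: "x \<bullet> (a *v x) \<le> 0" for x
  proof -
    have "- b \<le> - (a \<bullet> mat 1) + t * - (x \<bullet> (a *v x))" if "0 \<le> t" for t
      using ab(2)[OF pos_def_add_psd[OF pos_def_mat_1 psd_scaleR[OF psd_outer_product that]], of x]
      by (simp add: inner_add_right inner_outer_product)
    then show ?thesis using bounded_below_imp_slope_nonneg by fastforce
  qed
  have "0 \<le> b"
  proof (rule ccontr)
    assume "\<not> 0 \<le> b"
    \<comment> \<open>Chosen with \<open>\<epsilon> * (|a \<bullet> mat 1| + 1) = - b / 2\<close>:
      at \<epsilon> times the identity the functional is at least \<open>b / 2\<close>, which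
      exceeds the negative number \<open>b\<close>.\<close>
    define \<epsilon> where "\<epsilon> = - b / (2 * (\<bar>a \<bullet> mat 1\<bar> + 1))"
    have "\<epsilon> > 0" using \<open>\<not> 0 \<le> b\<close> by (simp add: \<epsilon>_def field_simps)
    then have "\<epsilon> * (a \<bullet> mat 1) \<le> b"
      using ab(2)[OF pos_def_scaleR[OF pos_def_mat_1]] by simp
    moreover have "- (\<epsilon> * (\<bar>a \<bullet> mat 1\<bar> + 1)) \<le> \<epsilon> * (a \<bullet> mat 1)"
      using \<open>\<epsilon> > 0\<close> by (simp flip: mult_minus_right)
    moreover have "\<epsilon> * (\<bar>a \<bullet> mat 1\<bar> + 1) = - b / 2"
      unfolding \<epsilon>_def by (rule nonzero_eq_divide_eq[THEN iffD1]) (auto simp: field_simps)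
    ultimately show False using \<open>\<not> 0 \<le> b\<close> by linarith
  qed
  have psd: "psd \<Omega>"
    using neg_form sym by (simp add: psd_def \<Omega>_def transpose_def vec_eq_iff minus_matrix_vector_mult)
  have aG: "a \<bullet> G = (\<Sum>k<d. (\<chi> i. p i k) \<bullet> (a *v (\<chi> i. p i k)))"
    unfolding G_def gram_eq_sum inner_sum_right inner_outer_product by simp
  \<comment> \<open>As \<open>G\<close> lies in \<open>T\<close> and \<open>b\<close> is
    nonnegative, this sum of nonpositive terms is nonnegative, so each term vanishes.\<close>
  have "0 \<le> (\<Sum>k<d. (\<chi> i. p i k) \<bullet> (a *v (\<chi> i. p i k)))"
    using ab(3)[OF GT] \<open>0 \<le> b\<close> aG by simp
  then have "(\<Sum>k<d. - ((\<chi> i. p i k) \<bullet> (a *v (\<chi> i. p i k)))) \<le> 0"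
    by (simp add: sum_negf)
  then have "(\<Sum>k<d. - ((\<chi> i. p i k) \<bullet> (a *v (\<chi> i. p i k)))) = 0"
    using neg_form by (intro antisym sum_nonneg) auto
  then have "\<forall>k\<in>{..<d}. - ((\<chi> i. p i k) \<bullet> (a *v (\<chi> i. p i k))) = 0"
    using neg_form by (subst (asm) sum_nonneg_eq_0_iff) auto
  then have "\<Omega> *v (\<chi> i. p i k) = 0" if "k < d" for k
    using that by (intro psd_kernel[OF psd]) (simp add: \<Omega>_def minus_matrix_vector_mult)
  moreover have "\<Omega> *v 1 = 0" using ker1 by (simp add: \<Omega>_def minus_matrix_vector_mult)
  ultimately have "stressed E (insert 1 ((\<lambda>k. \<chi> i. p i k) ` {..<d}))"
    unfolding stressed_def using ab(1) psd pat by (intro exI[of _ \<Omega>]) (auto simp: \<Omega>_def)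
  then show False using ns by simp
qed

text \<open>Moving vertex \<open>o'\<close> to the origin replaces \<open>A\<close> by the Gram
  matrix \<open>B\<close> of rank n - 1 with the same squared distances. Its factor has a zero row
  at \<open>o'\<close>, and the n - 1 remaining rows serve as coordinates.\<close>

lemma pos_def_realization:
  fixes A :: "real^'n^'n"
  assumes "pos_def A"
  shows "\<exists>q :: 'n framework. affinely_spanning (CARD('n) - 1) q \<and>
    (\<forall>i j. (\<Sum>k<CARD('n) - 1. (q i k - q j k)\<^sup>2) = A $ i $ i + A $ j $ j - 2 * A $ i $ j)"
proof -
  define o' :: 'n where "o' = undefined"
  define B :: "real^'n^'n" where
    "B = (\<chi> i j. A $ i $ j - A $ o' $ j - A $ i $ o' + A $ o' $ o')"
  \<comment> \<open>\<open>C\<close> projects onto the vectors with coefficient sum zero.\<close>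
  define C :: "real^'n \<Rightarrow> real^'n" where "C x = x - (\<Sum>i\<in>UNIV. x $ i) *\<^sub>R axis o' 1" for x
  have A_sym: "A $ i $ j = A $ j $ i" for i j
    using assms symmetric_nth by (auto simp: pos_def_def)
  have form: "x \<bullet> (B *v x) = C x \<bullet> (A *v C x)" for x
  proof -
    let ?s = "\<Sum>i\<in>UNIV. x $ i"
    have Ax: "(\<Sum>j\<in>UNIV. A $ i $ j * x $ j) = (A *v x) $ i" for i
      by (simp add: matrix_vector_mult_def)
    have Bx: "B *v x = A *v x - (A *v x) $ o' *\<^sub>R 1 - ?s *\<^sub>R (\<chi> i. A $ i $ o') + (?s * A $ o' $ o') *\<^sub>R 1"
      by (simp add: vec_eq_iff B_def matrix_vector_mult_def algebra_simps sum.distrib sum_subtractf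
          sum_distrib_left sum_distrib_right)
    have x1: "x \<bullet> 1 = ?s" by (simp add: inner_vec_def)
    have xo: "x \<bullet> (\<chi> i. A $ i $ o') = (A *v x) $ o'"
      using A_sym by (simp add: inner_vec_def matrix_vector_mult_def mult.commute)
    have "x \<bullet> (B *v x) = x \<bullet> (A *v x) - 2 * ?s * (A *v x) $ o' + ?s\<^sup>2 * A $ o' $ o'"
      unfolding Bx by (simp add: x1 xo inner_add_right inner_diff_right power2_eq_square algebra_simps)
    moreover have "A *v axis o' 1 = (\<chi> i. A $ i $ o')"
      by (simp add: matrix_vector_mult_basis column_def)
    ultimately show ?thesis
      by (simp add: xo C_def matrix_vector_mult_diff_distrib matrix_vector_mult_scaleR inner_diff_left
          inner_diff_right inner_axis' power2_eq_square algebra_simps)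
  qed
  have psd: "psd B"
    using pos_def_imp_psd[OF assms] A_sym
    by (auto simp: psd_def form) (auto simp: B_def transpose_def vec_eq_iff)
  have B0: "B $ o' $ o' = 0" by (simp add: B_def)
  obtain u where u: "B = gram u (UNIV :: 'n set)" "u o' = 0"
    using psd_eq_gram[OF psd] B0 by blast
  \<comment> \<open>The vacant row \<open>o'\<close> of the factor records the coefficient sum, so
    that surjectivity of the endomorphism \<open>F\<close> is affine spanning. It is injective since
    \<open>C\<close> fixes vectors of sum zero and \<open>A\<close> is definite.\<close>
  define F :: "real^'n \<Rightarrow> real^'n" where
    "F c = (\<chi> k. if k = o' then (\<Sum>i\<in>UNIV. c $ i) else u k \<bullet> c)" for c
  have lin: "linear F"
    by (rule linearI) (auto simp: F_def vec_eq_iff sum.distrib sum_distrib_left inner_add_right)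
  have "c = 0" if "F c = 0" for c
  proof -
    have Fk: "F c $ k = 0" for k using that by simp
    have s: "(\<Sum>i\<in>UNIV. c $ i) = 0" using Fk[of o'] by (simp add: F_def)
    have "u k \<bullet> c = 0" for k
      using Fk[of k] u(2) by (cases "k = o'") (auto simp: F_def)
    then have "c \<bullet> (B *v c) = 0" unfolding u(1) gram_quadratic by simp
    then have "C c = 0" using assms form[of c] unfolding pos_def_def by (metis less_irrefl)
    then show ?thesis using s by (simp add: C_def)
  qed
  then have "surj F" using linear_injective_imp_surjective[OF lin] linear_injective_0[OF lin] by blast
  have "card (UNIV - {o'}) = CARD('n) - 1" by simp
  then obtain g where g: "bij_betw g {..<CARD('n) - 1} (UNIV - {o'})"
    using ex_bij_betw_nat_finite[of "UNIV - {o'}"] by (auto simp: atLeast0LessThan)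
  define q :: "'n framework" where "q i k = u (g k) $ i" for i k
  have "affinely_spanning (CARD('n) - 1) q"
    unfolding affinely_spanning_def
  proof
    fix x :: "nat \<Rightarrow> real"
    obtain c where c: "F c = (\<chi> k. if k = o' then 1 else x (inv_into {..<CARD('n) - 1} g k))"
      using \<open>surj F\<close> by (metis surjD)
    have Fk: "F c $ k = (if k = o' then 1 else x (inv_into {..<CARD('n) - 1} g k))" for k
      using c by simp
    have "(\<Sum>i\<in>UNIV. c $ i) = 1" using Fk[of o'] by (simp add: F_def)
    moreover have "x k = (\<Sum>i\<in>UNIV. c $ i * q i k)" if "k < CARD('n) - 1" for k
    proof -
      have "g k \<noteq> o'" using g that by (auto simp: bij_betw_def)
      moreover have "inv_into {..<CARD('n) - 1} g (g k) = k"
        using g that by (auto simp: bij_betw_def)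
      ultimately have "u (g k) \<bullet> c = x k"
        using Fk[of "g k"] by (simp add: F_def)
      then show ?thesis by (simp add: q_def inner_vec_def mult.commute)
    qed
    ultimately show "\<exists>c :: 'n \<Rightarrow> real. (\<Sum>i\<in>UNIV. c i) = 1 \<and>
        (\<forall>k<CARD('n) - 1. x k = (\<Sum>i\<in>UNIV. c i * q i k))" by blast
  qed
  moreover have "(\<Sum>k<CARD('n) - 1. (q i k - q j k)\<^sup>2) = A $ i $ i + A $ j $ j - 2 * A $ i $ j" for i j
  proof -
    have "(\<Sum>k<CARD('n) - 1. (q i k - q j k)\<^sup>2) = (\<Sum>k\<in>UNIV - {o'}. (u k $ i - u k $ j)\<^sup>2)"
      unfolding q_def by (rule sum.reindex_bij_betw[OF g])
    also have "\<dots> = (\<Sum>k\<in>UNIV. (u k $ i - u k $ j)\<^sup>2)"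
      using u(2) by (simp add: sum.remove[of UNIV o'])
    also have "\<dots> = B $ i $ i + B $ j $ j - 2 * B $ i $ j"
      by (simp add: u(1) gram_def power2_eq_square algebra_simps sum.distrib sum_subtractf
          sum_distrib_left)
    also have "\<dots> = A $ i $ i + A $ j $ j - 2 * A $ i $ j"
      using A_sym[of i o'] A_sym[of j o'] by (simp add: B_def)
    finally show ?thesis .
  qed
  ultimately show ?thesis by blast
qed

theorem spanning_lift_iff_not_stressed:
  fixes p :: "'n::finite framework"
  assumes "sym E"
  shows "(\<exists>q. equivalent_frameworks E d p (CARD('n) - 1) q \<and> affinely_spanning (CARD('n) - 1) q)
    \<longleftrightarrow> \<not> stressed E (insert 1 ((\<lambda>k. \<chi> i. p i k) ` {..<d}))"
proof
  assume "\<not> stressed E (insert 1 ((\<lambda>k. \<chi> i. p i k) ` {..<d}))"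
  from not_stressed_imp_pos_def_completion[OF assms this] obtain A where A: "pos_def A"
    "\<forall>(i, j)\<in>E. A $ i $ i + A $ j $ j - 2 * A $ i $ j = (\<Sum>k<d. (p i k - p j k)\<^sup>2)" by blast
  from pos_def_realization[OF A(1)] obtain q :: "'n framework" where
    "affinely_spanning (CARD('n) - 1) q"
    "\<forall>i j. (\<Sum>k<CARD('n) - 1. (q i k - q j k)\<^sup>2) = A $ i $ i + A $ j $ j - 2 * A $ i $ j" by blast
  then have "equivalent_frameworks E d p (CARD('n) - 1) q \<and> affinely_spanning (CARD('n) - 1) q"
    using A(2) unfolding equivalent_frameworks_def point_dist_eq_iff by auto
  then show "\<exists>q. equivalent_frameworks E d p (CARD('n) - 1) q \<and> affinely_spanning (CARD('n) - 1) q"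
    by blast
qed (use spanning_lift_imp_not_stressed in blast)

subsection \<open>Existence of the maximum likelihood estimator\<close>

lemma det_pos_def_nonzero:
  fixes K :: "real^'n^'n"
  assumes "pos_def K"
  shows "det K \<noteq> 0"
proof -
  have "x = 0" if "K *v x = 0" for x
    using assms that by (metis inner_zero_right less_irrefl pos_def_def)
  then have "invertible K" by (simp add: invertible_left_inverse matrix_left_invertible_ker)
  then show ?thesis by (simp add: invertible_det_nz)
qed

lemma continuous_on_det [continuous_intros]:
  fixes f :: "'a::topological_space \<Rightarrow> real^'n^'n"
  assumes "continuous_on S f"
  shows "continuous_on S (\<lambda>x. det (f x))"
  unfolding det_def by (intro continuous_intros assms)

text \<open>The segment to the identity stays positive definite, so the determinant cannot change
  sign along it.\<close>

lemma det_pos_def_pos: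
  fixes K :: "real^'n^'n"
  assumes "pos_def K"
  shows "det K > 0"
proof (rule ccontr)
  define f where "f t = det ((1 - t) *\<^sub>R mat 1 + t *\<^sub>R K)" for t :: real
  assume "\<not> det K > 0"
  then have "f 1 \<le> 0" "0 \<le> f 0" by (auto simp: f_def)
  moreover have "continuous_on {0..1} f" unfolding f_def by (intro continuous_intros)
  ultimately obtain t where t: "0 \<le> t" "t \<le> 1" "f t = 0"
    using IVT2'[of f 1 0 0] by auto
  have "pos_def ((1 - t) *\<^sub>R mat 1 + t *\<^sub>R K)"
    using convexD[OF pos_def_convex, of "mat 1" K "1 - t" t] assms pos_def_mat_1 t by auto
  then show False using det_pos_def_nonzero t(3) by (auto simp: f_def)
qed

lemma psd_det_nonzero_imp_pos_def:
  fixes K :: "real^'n^'n"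
  assumes "psd K" "det K \<noteq> 0"
  shows "pos_def K"
proof -
  have "x \<bullet> (K *v x) > 0" if "x \<noteq> 0" for x
  proof -
    have "K *v x \<noteq> 0"
      using assms(2) that by (metis invertible_det_nz invertible_left_inverse matrix_left_invertible_ker)
    then show ?thesis using psd_kernel[OF assms(1)] assms(1)
      by (metis order_le_less psd_def)
  qed
  then show ?thesis using assms(1) by (simp add: pos_def_def psd_def)
qed

text \<open>The maximum of the generalized Rayleigh quotient is a generalized eigenvalue, so the
  polynomial \<open>det (K + t \<Omega>)\<close> has a root and is not constant.\<close>

lemma det_add_psd_singular:
  fixes K \<Omega> :: "real^'n^'n"
  assumes K: "pos_def K" and \<Omega>: "psd \<Omega>" "\<Omega> \<noteq> 0"
  shows "\<exists>t. det (K + t *\<^sub>R \<Omega>) = 0"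
proof -
  define r where "r x = (x \<bullet> (\<Omega> *v x)) / (x \<bullet> (K *v x))" for x
  let ?S = "sphere (0 :: real^'n) 1"
  have Kpos: "x \<bullet> (K *v x) > 0" if "x \<noteq> 0" for x using K that by (simp add: pos_def_def)
  have "x \<bullet> (K *v x) \<noteq> 0" if "x \<in> ?S" for x
    using that Kpos[of x] by (cases "x = 0") auto
  then have "continuous_on ?S r"
    unfolding r_def
    by (intro continuous_intros matrix_vector_mult_linear_continuous_on ballI) blast
  moreover have "?S \<noteq> {}" by simp
  ultimately obtain x0 where x0: "x0 \<in> ?S" "\<And>x. x \<in> ?S \<Longrightarrow> r x \<le> r x0"
    using continuous_attains_sup[OF compact_sphere] by blast
  define l where "l = r x0"
  have "x0 \<noteq> 0" using x0(1) by auto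
  have le: "x \<bullet> (\<Omega> *v x) \<le> l * (x \<bullet> (K *v x))" for x
  proof (cases "x = 0")
    case False
    then have "r (x /\<^sub>R norm x) \<le> l" unfolding l_def by (intro x0(2)) simp
    moreover have "r (x /\<^sub>R norm x) = r x"
      using False by (simp add: r_def matrix_vector_mult_scaleR)
    ultimately have "(x \<bullet> (\<Omega> *v x)) / (x \<bullet> (K *v x)) \<le> l" by (simp only: r_def)
    then show ?thesis using Kpos[OF False] by (simp add: pos_divide_le_eq)
  qed simp
  have eq: "x0 \<bullet> (\<Omega> *v x0) = l * (x0 \<bullet> (K *v x0))"
    using Kpos[OF \<open>x0 \<noteq> 0\<close>] by (simp add: l_def r_def)
  have "l > 0"
  proof -
    have "\<exists>x. x \<bullet> (\<Omega> *v x) \<noteq> 0"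
    proof (rule ccontr)
      assume "\<not> ?thesis"
      then have "\<Omega> *v x = 0" for x using psd_kernel[OF \<Omega>(1)] by blast
      then have "\<Omega> = 0" by (simp add: matrix_eq)
      then show False using \<Omega>(2) by simp
    qed
    then obtain x where x: "x \<bullet> (\<Omega> *v x) > 0" using \<Omega>(1) by (metis order_le_less psd_def)
    then have "x \<noteq> 0" by auto
    then show ?thesis using le[of x] x Kpos[of x] by (metis less_le_trans zero_less_mult_pos2)
  qed
  \<comment> \<open>Maximality of \<open>l\<close> makes \<open>M\<close> semidefinite, and its form
    vanishes at the maximiser, which therefore lies in its kernel. So \<open>- (1 / l)\<close> is a
    root of the determinant.\<close>
  define M where "M = l *\<^sub>R K - \<Omega>"
  have "transpose M = M" using K \<Omega>(1)
    by (auto simp: M_def pos_def_def psd_def transpose_def vec_eq_iff)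
  moreover have form: "x \<bullet> (M *v x) = l * (x \<bullet> (K *v x)) - x \<bullet> (\<Omega> *v x)" for x
    by (simp add: M_def matrix_vector_mult_diff_rdistrib inner_diff_right flip: scaleR_matrix_vector_assoc)
  ultimately have "psd M" using le by (simp add: psd_def)
  then have "M *v x0 = 0" by (rule psd_kernel) (simp add: form eq)
  moreover have "K + (- (1 / l)) *\<^sub>R \<Omega> = (1 / l) *\<^sub>R M"
    using \<open>l > 0\<close> by (simp add: M_def scaleR_right_diff_distrib)
  ultimately have "(K + (- (1 / l)) *\<^sub>R \<Omega>) *v x0 = 0"
    by (simp flip: scaleR_matrix_vector_assoc)
  then have "det (K + (- (1 / l)) *\<^sub>R \<Omega>) = 0"
    using \<open>x0 \<noteq> 0\<close> by (metis invertible_det_nz invertible_left_inverse matrix_left_invertible_ker)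
  then show ?thesis by blast
qed

text \<open>The determinant is a polynomial in \<open>t\<close> that has a root but is nonzero at 0,
  hence nonconstant and unbounded in absolute value; for nonnegative \<open>t\<close> it is
  positive.\<close>

lemma det_add_psd_unbounded:
  fixes K \<Omega> :: "real^'n^'n"
  assumes K: "pos_def K" and \<Omega>: "psd \<Omega>" "\<Omega> \<noteq> 0"
  shows "\<exists>t\<ge>0. det (K + t *\<^sub>R \<Omega>) > b"
proof -
  define q where "q = (\<Sum>\<pi> | \<pi> permutes (UNIV :: 'n set). [:of_int (sign \<pi>):] *
      (\<Prod>i\<in>UNIV. [:K $ i $ \<pi> i, \<Omega> $ i $ \<pi> i:]))"
  have q: "poly q t = det (K + t *\<^sub>R \<Omega>)" for t
    by (simp add: q_def det_def poly_sum poly_prod)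
  obtain t where "poly q t = 0" using det_add_psd_singular[OF assms] by (auto simp: q)
  moreover have "poly q 0 \<noteq> 0" using det_pos_def_nonzero[OF K] by (simp add: q)
  ultimately have "degree q > 0" by (cases "degree q = 0") (auto elim: degree_eq_zeroE)
  then have "filterlim (poly q) at_infinity at_infinity" by (rule filterlim_poly_at_infinity)
  then have "filterlim (poly q) at_infinity at_top"
    by (rule filterlim_mono[OF _ order_refl at_top_le_at_infinity])
  then have "eventually (\<lambda>t. \<bar>b\<bar> + 1 \<le> norm (poly q t)) at_top"
    by (subst (asm) filterlim_at_infinity[of 0]) (auto dest: spec[of _ "\<bar>b\<bar> + 1"])
  then have "eventually (\<lambda>t. 0 \<le> t \<and> \<bar>b\<bar> + 1 \<le> norm (poly q t)) at_top"
    using eventually_ge_at_top[of 0] by eventually_elim auto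
  then obtain t where t: "0 \<le> t" "\<bar>b\<bar> + 1 \<le> norm (poly q t)"
    by (auto simp: eventually_at_top_linorder)
  have "poly q t > 0"
    unfolding q by (intro det_pos_def_pos pos_def_add_psd K psd_scaleR \<Omega> t)
  then show ?thesis using t by (intro exI[of _ t]) (auto simp: q)
qed

section \<open>Coercivity of the objective\<close>

lemma trace_sample_cov:
  "trace (sample_cov N X ** K) = (\<Sum>k<N. X k \<bullet> (K *v X k)) / real N"
proof -
  have "trace (sample_cov N X ** K) = (\<Sum>i\<in>UNIV. \<Sum>j\<in>UNIV. \<Sum>k<N. X k $ i * X k $ j * K $ j $ i / real N)"
    by (simp add: trace_def matrix_matrix_mult_def sample_cov_def sum_distrib_right sum_divide_distrib)
  also have "\<dots> = (\<Sum>i\<in>UNIV. \<Sum>k<N. \<Sum>j\<in>UNIV. X k $ i * X k $ j * K $ j $ i / real N)"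
    by (intro sum.cong refl sum.swap)
  also have "\<dots> = (\<Sum>k<N. \<Sum>i\<in>UNIV. \<Sum>j\<in>UNIV. X k $ i * X k $ j * K $ j $ i / real N)"
    by (rule sum.swap)
  also have "\<dots> = (\<Sum>k<N. (\<Sum>j\<in>UNIV. \<Sum>i\<in>UNIV. X k $ i * X k $ j * K $ j $ i / real N))"
    by (intro sum.cong refl sum.swap)
  finally show ?thesis
    by (simp add: quadratic_form_sum sum_divide_distrib algebra_simps)
qed

lemma trace_sample_cov_zero_iff:
  assumes "psd K" "1 \<le> N"
  shows "trace (sample_cov N X ** K) = 0 \<longleftrightarrow> (\<forall>k<N. K *v X k = 0)"
proof -
  have "(\<Sum>k<N. X k \<bullet> (K *v X k)) = 0 \<longleftrightarrow> (\<forall>k\<in>{..<N}. X k \<bullet> (K *v X k) = 0)"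
    using assms(1) by (intro sum_nonneg_eq_0_iff) (auto simp: psd_def)
  then show ?thesis using assms psd_kernel[OF assms(1)] by (auto simp: trace_sample_cov)
qed

lemma trace_sample_cov_nonneg: "psd K \<Longrightarrow> 0 \<le> trace (sample_cov N X ** K)"
  by (auto simp: trace_sample_cov psd_def intro!: divide_nonneg_nonneg sum_nonneg)

lemma psd_entry_le_trace:
  assumes "psd K"
  shows "\<bar>K $ i $ j\<bar> \<le> trace K"
proof -
  have tr: "K $ a $ a \<le> trace K" for a
    unfolding trace_def using psd_diag_nonneg[OF assms] by (intro member_le_sum) auto
  have "(K $ i $ j)\<^sup>2 \<le> K $ i $ i * K $ j $ j"
    using psd_cauchy_schwarz[OF assms, of "axis i 1" "axis j 1"] by (simp add: axis_quadratic)
  also have "\<dots> \<le> (trace K)\<^sup>2"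
    unfolding power2_eq_square using tr psd_diag_nonneg[OF assms]
    by (intro mult_mono) (auto intro: order_trans)
  finally show ?thesis
    using tr[of i] psd_diag_nonneg[OF assms, of i] by (simp add: abs_le_square_iff[symmetric])
qed

text \<open>Leibniz expansion with every entry bounded by the trace. It is the polynomial growth
  that counts: its logarithm loses against a linear function of the trace.\<close>

lemma psd_det_le_trace_power:
  fixes K :: "real^'n^'n"
  assumes "psd K"
  shows "det K \<le> fact CARD('n) * trace K ^ CARD('n)"
proof -
  have "\<bar>det K\<bar> \<le> (\<Sum>\<pi> | \<pi> permutes (UNIV :: 'n set). \<bar>of_int (sign \<pi>) * (\<Prod>i\<in>UNIV. K $ i $ \<pi> i)\<bar>)"
    unfolding det_def by (rule sum_abs)
  also have "\<dots> \<le> (\<Sum>\<pi> | \<pi> permutes (UNIV :: 'n set). trace K ^ CARD('n))"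
  proof (rule sum_mono)
    fix \<pi> :: "'n \<Rightarrow> 'n"
    have "(\<Prod>i\<in>UNIV. \<bar>K $ i $ \<pi> i\<bar>) \<le> (\<Prod>i\<in>(UNIV :: 'n set). trace K)"
      by (intro prod_mono) (use psd_entry_le_trace[OF assms] in auto)
    then show "\<bar>of_int (sign \<pi>) * (\<Prod>i\<in>UNIV. K $ i $ \<pi> i)\<bar> \<le> trace K ^ CARD('n)"
      by (simp add: abs_mult abs_prod sign_def)
  qed
  also have "\<dots> = fact CARD('n) * trace K ^ CARD('n)"
    by (simp add: card_permutations[of UNIV])
  finally show ?thesis by simp
qed

lemma bounded_psd_trace: "bounded {K :: real^'n^'n. psd K \<and> trace K \<le> R}"
proof (rule boundedI)
  fix K :: "real^'n^'n" assume "K \<in> {K. psd K \<and> trace K \<le> R}"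
  then have "\<bar>K $ i $ j\<bar> \<le> R" for i j
    using psd_entry_le_trace[of K i j] by simp
  then have "(\<Sum>i\<in>UNIV. \<Sum>j\<in>UNIV. \<bar>K $ i $ j\<bar>) \<le> (\<Sum>i\<in>(UNIV :: 'n set). \<Sum>j\<in>(UNIV :: 'n set). R)"
    by (intro sum_mono)
  moreover have "norm K \<le> (\<Sum>i\<in>UNIV. norm (K $ i))"
    unfolding norm_vec_def[of K] by (rule L2_set_le_sum) simp
  moreover have "\<dots> \<le> (\<Sum>i\<in>UNIV. \<Sum>j\<in>UNIV. \<bar>K $ i $ j\<bar>)"
    by (intro sum_mono norm_le_l1_cart)
  ultimately show "norm K \<le> (\<Sum>i\<in>(UNIV :: 'n set). \<Sum>j\<in>(UNIV :: 'n set). R)" by linarith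
qed

lemma continuous_on_trace_mult: "continuous_on S (\<lambda>K. trace (A ** K))"
  for A :: "real^'n^'n"
  unfolding trace_def matrix_matrix_mult_def by (simp, intro continuous_intros)

lemma continuous_on_trace: "continuous_on S (trace :: real^'n^'n \<Rightarrow> real)"
  using continuous_on_trace_mult[of S "mat 1"] by simp

text \<open>A closed cone whose nonsingular members form the model. Limits of model matrices stay
  inside, so compactness can be applied here.\<close>

definition psd_pattern :: "('n::finite \<times> 'n) set \<Rightarrow> (real^'n^'n) set" where
  "psd_pattern E = {K. psd K \<and> (\<forall>i j. i \<noteq> j \<and> (i, j) \<notin> E \<longrightarrow> K $ i $ j = 0)}"

lemma closed_psd_pattern: "closed (psd_pattern E)"
proof -
  have *: "psd_pattern E = (\<Inter>i. \<Inter>j. {K. K $ i $ j = K $ j $ i}) \<inter> (\<Inter>x. {K. 0 \<le> x \<bullet> (K *v x)}) \<inter>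
      (\<Inter>i. \<Inter>j. {K. i \<noteq> j \<and> (i, j) \<notin> E \<longrightarrow> K $ i $ j = 0})"
    by (auto simp: psd_pattern_def psd_def transpose_def vec_eq_iff)
  show ?thesis
    unfolding * quadratic_form_sum
    by (intro closed_Int closed_INT ballI closed_Collect_eq closed_Collect_le closed_Collect_imp
        open_Collect_const continuous_intros)
qed

lemma stressed_iff_psd_pattern:
  "stressed E V \<longleftrightarrow> (\<exists>\<Omega>\<in>psd_pattern E. \<Omega> \<noteq> 0 \<and> (\<forall>v\<in>V. \<Omega> *v v = 0))"
  by (auto simp: stressed_def psd_pattern_def)

lemma model_matrices_eq: "model_matrices E = {K \<in> psd_pattern E. det K \<noteq> 0}"
  using psd_det_nonzero_imp_pos_def det_pos_def_nonzero pos_def_imp_psd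
  by (auto simp: model_matrices_def psd_pattern_def)

lemma mat_1_in_model: "mat 1 \<in> model_matrices E"
  using pos_def_mat_1 by (auto simp: model_matrices_def mat_def)

lemma trace_pos_def_pos:
  fixes K :: "real^'n^'n"
  assumes "pos_def K"
  shows "trace K > 0"
proof -
  have "K $ i $ i > 0" for i
    using assms axis_quadratic[of i K i] unfolding pos_def_def by (metis axis_eq_0_iff zero_neq_one)
  then show ?thesis unfolding trace_def by (intro sum_pos) auto
qed

text \<open>By homogeneity the constant is the minimum of the trace term on the compact slice of
  trace 1. A minimum of zero would be attained at a stress.\<close>

lemma not_stressed_trace_bound:
  fixes X :: "nat \<Rightarrow> real^'n::finite"
  assumes "1 \<le> N" and ns: "\<not> stressed E (X ` {..<N})"
  shows "\<exists>c>0. \<forall>K\<in>model_matrices E. c * trace K \<le> trace (sample_cov N X ** K)"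
proof -
  let ?S = "sample_cov N X"
  define D where "D = psd_pattern E \<inter> {K. trace K = 1}"
  have "closed D" unfolding D_def
    by (intro closed_Int closed_psd_pattern closed_Collect_eq continuous_on_trace continuous_on_const)
  moreover have "bounded D"
    by (rule bounded_subset[OF bounded_psd_trace[of 1]]) (auto simp: D_def psd_pattern_def)
  ultimately have "compact D" by (simp add: compact_eq_bounded_closed)
  have scale: "(1 / trace K) *\<^sub>R K \<in> D" if "K \<in> model_matrices E" for K
  proof -
    have "trace K > 0" using that trace_pos_def_pos by (auto simp: model_matrices_def)
    moreover have "trace (c *\<^sub>R K) = c * trace K" for c by (simp add: trace_def sum_distrib_left)
    ultimately show ?thesis using that
      by (auto simp: D_def psd_pattern_def model_matrices_def intro!: psd_scaleR[OF pos_def_imp_psd])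
  qed
  then have "D \<noteq> {}" using mat_1_in_model by blast
  then obtain K0 where K0: "K0 \<in> D" "\<And>K. K \<in> D \<Longrightarrow> trace (?S ** K0) \<le> trace (?S ** K)"
    using continuous_attains_inf[OF \<open>compact D\<close> _ continuous_on_trace_mult] by blast
  define c where "c = trace (?S ** K0)"
  have "psd K0" using K0(1) by (simp add: D_def psd_pattern_def)
  have "K0 \<noteq> 0" using K0(1) by (auto simp: D_def trace_def)
  then have "c \<noteq> 0"
    using ns trace_sample_cov_zero_iff[OF \<open>psd K0\<close> assms(1)] K0(1)
    unfolding c_def stressed_iff_psd_pattern by (auto simp: D_def)
  then have "c > 0" using trace_sample_cov_nonneg[OF \<open>psd K0\<close>] by (metis c_def order_le_less)
  moreover have "c * trace K \<le> trace (?S ** K)" if "K \<in> model_matrices E" for K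
  proof -
    have tr: "trace K > 0" using that trace_pos_def_pos by (auto simp: model_matrices_def)
    have "c \<le> trace (?S ** ((1 / trace K) *\<^sub>R K))" unfolding c_def by (rule K0(2)[OF scale[OF that]])
    also have "\<dots> = trace (?S ** K) / trace K"
      by (simp add: trace_def matrix_matrix_mult_def sum_divide_distrib)
    finally show ?thesis using tr by (simp add: field_simps)
  qed
  ultimately show ?thesis by blast
qed

lemma not_stressed_imp_mle_exists:
  fixes X :: "nat \<Rightarrow> real^'n::finite"
  assumes "1 \<le> N" and ns: "\<not> stressed E (X ` {..<N})"
  shows "mle_exists E N X"
proof -
  let ?S = "sample_cov N X" let ?n = "real CARD('n)"
  define h where "h = mle_objective ?S"
  define m where "m = h (mat 1)"
  obtain c where c: "c > 0" "\<And>K. K \<in> model_matrices E \<Longrightarrow> c * trace K \<le> trace (?S ** K)"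
    using not_stressed_trace_bound[OF assms] by blast
  \<comment> \<open>By \<open>ln x \<le> x\<close> at \<open>x = \<epsilon> * trace K\<close>, the
    logarithm of the determinant costs at most half of \<open>c * trace K\<close>, up to a constant;
    the other half yields the bound \<open>R\<close>.\<close>
  define \<epsilon> where "\<epsilon> = c / (2 * ?n)"
  have "\<epsilon> > 0" using c(1) by (simp add: \<epsilon>_def)
  define R where "R = 2 * (m + ln (fact CARD('n)) - ?n * ln \<epsilon>) / c"
  \<comment> \<open>The lower bound on the determinant comes from the trace term being nonnegative.
    It keeps this compact set away from singular matrices, so the objective is continuous on
    it.\<close>
  define M where "M = psd_pattern E \<inter> {K. trace K \<le> R} \<inter> {K. exp (- m) \<le> det K}"
  have sub: "K \<in> M" if K: "K \<in> model_matrices E" and hK: "h K \<le> m" for K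
  proof -
    have pd: "pos_def K" using K by (simp add: model_matrices_def)
    have tr: "trace K > 0" and dp: "det K > 0"
      using trace_pos_def_pos det_pos_def_pos pd by blast+
    have "ln (det K) \<le> ln (fact CARD('n) * trace K ^ CARD('n))"
      using psd_det_le_trace_power[OF pos_def_imp_psd[OF pd]] dp tr by simp
    also have "\<dots> = ln (fact CARD('n)) + ?n * ln (trace K)"
      using tr by (simp add: ln_mult ln_realpow)
    finally have 1: "ln (det K) \<le> ln (fact CARD('n)) + ?n * ln (trace K)" .
    have "ln (\<epsilon> * trace K) \<le> \<epsilon> * trace K"
      using ln_le_minus_one[of "\<epsilon> * trace K"] tr \<open>\<epsilon> > 0\<close> by simp
    then have "ln (trace K) \<le> \<epsilon> * trace K - ln \<epsilon>"
      using tr \<open>\<epsilon> > 0\<close> by (simp add: ln_mult)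
    then have "?n * ln (trace K) \<le> ?n * (\<epsilon> * trace K - ln \<epsilon>)" by (intro mult_left_mono) auto
    also have "\<dots> = c * trace K / 2 - ?n * ln \<epsilon>" by (simp add: \<epsilon>_def field_simps)
    finally have 2: "?n * ln (trace K) \<le> c * trace K / 2 - ?n * ln \<epsilon>" .
    have 3: "trace (?S ** K) - ln (det K) \<le> m" using hK by (simp add: h_def mle_objective_def)
    have "c * trace K / 2 \<le> m + ln (fact CARD('n)) - ?n * ln \<epsilon>"
      using 1 2 3 c(2)[OF K] by linarith
    then have "trace K \<le> R" using c(1) by (simp add: R_def field_simps)
    moreover have "- m \<le> ln (det K)"
      using 3 trace_sample_cov_nonneg[OF pos_def_imp_psd[OF pd], of N X] by linarith
    then have "exp (- m) \<le> det K" using dp by (simp add: ln_ge_iff)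
    ultimately show ?thesis using K by (auto simp: M_def model_matrices_eq)
  qed
  have MM: "K \<in> model_matrices E" if "K \<in> M" for K
    using that by (auto simp: M_def model_matrices_eq)
  have "closed M" unfolding M_def
    by (intro closed_Int closed_psd_pattern closed_Collect_le continuous_on_trace continuous_on_const
        continuous_on_det continuous_on_id)
  moreover have "bounded M"
    by (rule bounded_subset[OF bounded_psd_trace[of R]]) (auto simp: M_def psd_pattern_def)
  ultimately have "compact M" by (simp add: compact_eq_bounded_closed)
  have det_M: "0 < det K" if "K \<in> M" for K
    using that less_le_trans[OF exp_gt_zero] unfolding M_def by blast
  have "continuous_on M h"
    unfolding h_def mle_objective_def
    by (intro continuous_on_diff continuous_on_trace_mult continuous_on_ln continuous_on_det
        continuous_on_id ballI) (use det_M in force)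
  moreover have "mat 1 \<in> M" by (rule sub[OF mat_1_in_model]) (simp add: m_def)
  ultimately obtain K where K: "K \<in> M" "\<And>K'. K' \<in> M \<Longrightarrow> h K \<le> h K'"
    using continuous_attains_inf[OF \<open>compact M\<close>] by blast
  have "h K \<le> h K'" if "K' \<in> model_matrices E" for K'
    using K sub[OF that] \<open>mat 1 \<in> M\<close> unfolding m_def by (metis linear order_trans)
  then show ?thesis unfolding mle_exists_def h_def using MM[OF K(1)] by blast
qed

text \<open>Adding multiples of a stress leaves the trace term unchanged while the determinant
  exceeds every bound.\<close>

lemma mle_exists_imp_not_stressed:
  fixes X :: "nat \<Rightarrow> real^'n::finite"
  assumes "1 \<le> N" and mle: "mle_exists E N X"
  shows "\<not> stressed E (X ` {..<N})"
proof
  assume "stressed E (X ` {..<N})"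
  then obtain \<Omega> where \<Omega>: "\<Omega> \<in> psd_pattern E" "\<Omega> \<noteq> 0" "\<And>k. k < N \<Longrightarrow> \<Omega> *v X k = 0"
    unfolding stressed_iff_psd_pattern by auto
  have psd: "psd \<Omega>" using \<Omega>(1) by (simp add: psd_pattern_def)
  obtain K where K: "K \<in> model_matrices E"
    "\<And>K'. K' \<in> model_matrices E \<Longrightarrow> mle_objective (sample_cov N X) K \<le> mle_objective (sample_cov N X) K'"
    using mle unfolding mle_exists_def by blast
  have pd: "pos_def K" using K(1) by (simp add: model_matrices_def)
  obtain t where t: "t \<ge> 0" "det (K + t *\<^sub>R \<Omega>) > det K"
    using det_add_psd_unbounded[OF pd psd \<Omega>(2)] by blast
  have "K + t *\<^sub>R \<Omega> \<in> model_matrices E"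
    using K(1) \<Omega>(1) t(1) by (auto simp: model_matrices_def psd_pattern_def intro!: pos_def_add_psd psd_scaleR)
  moreover have "trace (sample_cov N X ** (K + t *\<^sub>R \<Omega>)) = trace (sample_cov N X ** K)"
    unfolding trace_sample_cov using \<Omega>(3)
    by (simp add: matrix_vector_mult_add_rdistrib inner_add_right flip: scaleR_matrix_vector_assoc)
  ultimately have "ln (det (K + t *\<^sub>R \<Omega>)) \<le> ln (det K)"
    using K(2)[of "K + t *\<^sub>R \<Omega>"] by (simp add: mle_objective_def)
  then show False using t(2) det_pos_def_pos[OF pd] by simp
qed

theorem mle_exists_iff_not_stressed:
  "1 \<le> N \<Longrightarrow> mle_exists E N X \<longleftrightarrow> \<not> stressed E (X ` {..<N})"
  using mle_exists_imp_not_stressed not_stressed_imp_mle_exists by blast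

subsection \<open>Continuing algebraic relations along a sequence\<close>

text \<open>A pair \<open>(a, s)\<close> in such a ring continues the number \<open>a\<close> along the sequence \<open>s\<close>: every
  integral polynomial relation between the numbers is eventually satisfied by the sequences.\<close>

definition tracking :: "(real \<times> (nat \<Rightarrow> real)) set \<Rightarrow> bool" where
  "tracking T \<longleftrightarrow> (1, \<lambda>n. 1) \<in> T \<and>
    (\<forall>a s b t. (a, s) \<in> T \<and> (b, t) \<in> T \<longrightarrow>
       (a + b, \<lambda>n. s n + t n) \<in> T \<and> (a - b, \<lambda>n. s n - t n) \<in> T \<and> (a * b, \<lambda>n. s n * t n) \<in> T) \<and>
    (\<forall>a s. (a, s) \<in> T \<longrightarrow> s \<longlonglongrightarrow> a) \<and>
    (\<forall>s. (0, s) \<in> T \<longrightarrow> (\<forall>\<^sub>F n in sequentially. s n = 0))"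

lemma
  assumes "tracking T"
  shows tracking_one: "(1, \<lambda>n. 1) \<in> T"
    and tracking_add: "(a, s) \<in> T \<Longrightarrow> (b, t) \<in> T \<Longrightarrow> (a + b, \<lambda>n. s n + t n) \<in> T"
    and tracking_diff: "(a, s) \<in> T \<Longrightarrow> (b, t) \<in> T \<Longrightarrow> (a - b, \<lambda>n. s n - t n) \<in> T"
    and tracking_mult: "(a, s) \<in> T \<Longrightarrow> (b, t) \<in> T \<Longrightarrow> (a * b, \<lambda>n. s n * t n) \<in> T"
    and tracking_tendsto: "(a, s) \<in> T \<Longrightarrow> s \<longlonglongrightarrow> a"
    and tracking_zero_eventually: "(0, s) \<in> T \<Longrightarrow> \<forall>\<^sub>F n in sequentially. s n = 0"
  using assms unfolding tracking_def by blast+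

lemma tracking_zero: "tracking T \<Longrightarrow> (0, \<lambda>n. 0) \<in> T"
  using tracking_diff[OF _ tracking_one tracking_one, of T] by simp

lemma tracking_of_nat: "tracking T \<Longrightarrow> (of_nat k, \<lambda>n. of_nat k) \<in> T"
  by (induction k) (auto simp: tracking_zero dest: tracking_add[OF _ tracking_one])

lemma tracking_sum:
  assumes "tracking T" "\<And>i. i \<in> A \<Longrightarrow> (a i, \<lambda>n. s n i) \<in> T"
  shows "(\<Sum>i\<in>A. a i, \<lambda>n. \<Sum>i\<in>A. s n i) \<in> T"
  using assms(2)
  by (induction A rule: infinite_finite_induct) (auto simp: tracking_zero assms(1) intro: tracking_add[OF assms(1)])

text \<open>The degree bound makes coefficients that vanish eventually vanish simultaneously.\<close>

definition tracking_poly :: "(real \<times> (nat \<Rightarrow> real)) set \<Rightarrow> (real poly \<times> (nat \<Rightarrow> real poly)) set" where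
  "tracking_poly T = {(p, P). (\<forall>i. (coeff p i, \<lambda>n. coeff (P n) i) \<in> T) \<and> (\<exists>D. \<forall>n. degree (P n) \<le> D)}"

context
  fixes T assumes T: "tracking T"
begin

lemma tracking_poly_coeff: "(p, P) \<in> tracking_poly T \<Longrightarrow> (coeff p i, \<lambda>n. coeff (P n) i) \<in> T"
  by (simp add: tracking_poly_def)

lemma tracking_poly_add:
  assumes "(p, P) \<in> tracking_poly T" "(q, Q) \<in> tracking_poly T"
  shows "(p + q, \<lambda>n. P n + Q n) \<in> tracking_poly T"
proof -
  obtain D D' where "\<forall>n. degree (P n) \<le> D" "\<forall>n. degree (Q n) \<le> D'"
    using assms by (auto simp: tracking_poly_def)
  then have "\<forall>n. degree (P n + Q n) \<le> max D D'" by (meson degree_add_le max.cobounded1 max.cobounded2 order_trans)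
  then show ?thesis using assms T by (auto simp: tracking_poly_def intro: tracking_add)
qed

lemma tracking_poly_diff:
  assumes "(p, P) \<in> tracking_poly T" "(q, Q) \<in> tracking_poly T"
  shows "(p - q, \<lambda>n. P n - Q n) \<in> tracking_poly T"
proof -
  obtain D D' where "\<forall>n. degree (P n) \<le> D" "\<forall>n. degree (Q n) \<le> D'"
    using assms by (auto simp: tracking_poly_def)
  then have "\<forall>n. degree (P n - Q n) \<le> max D D'" by (meson degree_diff_le max.cobounded1 max.cobounded2 order_trans)
  then show ?thesis using assms T by (auto simp: tracking_poly_def intro: tracking_diff)
qed

lemma tracking_poly_mult:
  assumes "(p, P) \<in> tracking_poly T" "(q, Q) \<in> tracking_poly T"
  shows "(p * q, \<lambda>n. P n * Q n) \<in> tracking_poly T"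
proof -
  obtain D D' where "\<forall>n. degree (P n) \<le> D" "\<forall>n. degree (Q n) \<le> D'"
    using assms by (auto simp: tracking_poly_def)
  then have "\<forall>n. degree (P n * Q n) \<le> D + D'" by (meson add_mono degree_mult_le order_trans)
  moreover have "(coeff (p * q) i, \<lambda>n. coeff (P n * Q n) i) \<in> T" for i
    unfolding coeff_mult using assms
    by (intro tracking_sum[OF T] tracking_mult[OF T] tracking_poly_coeff)
  ultimately show ?thesis by (auto simp: tracking_poly_def)
qed

lemma tracking_poly_const: "(a, s) \<in> T \<Longrightarrow> ([:a:], \<lambda>n. [:s n:]) \<in> tracking_poly T"
  by (auto simp: tracking_poly_def coeff_pCons tracking_zero[OF T] split: nat.splits)

lemma tracking_poly_monom: "(monom 1 k, \<lambda>n. monom 1 k) \<in> tracking_poly T"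
  by (auto simp: tracking_poly_def tracking_zero[OF T] tracking_one[OF T])

lemma tracking_poly_pderiv:
  assumes "(p, P) \<in> tracking_poly T"
  shows "(pderiv p, \<lambda>n. pderiv (P n)) \<in> tracking_poly T"
proof -
  have "(coeff (pderiv p) i, \<lambda>n. coeff (pderiv (P n)) i) \<in> T" for i
    unfolding coeff_pderiv by (intro tracking_mult[OF T] tracking_of_nat[OF T] tracking_poly_coeff assms)
  moreover have "degree (pderiv (P n)) \<le> degree (P n)" for n by (simp add: degree_pderiv)
  ultimately show ?thesis using assms order_trans by (auto simp: tracking_poly_def) blast
qed

lemma tracking_poly_tendsto:
  assumes "(p, P) \<in> tracking_poly T" "t \<longlonglongrightarrow> y"
  shows "(\<lambda>n. poly (P n) (t n)) \<longlonglongrightarrow> poly p y"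
proof -
  obtain D where D: "\<And>n. degree (P n) \<le> D" using assms(1) by (auto simp: tracking_poly_def)
  \<comment> \<open>One summation range serves all \<open>n\<close>, so that the limit can be taken
    termwise.\<close>
  define D' where "D' = max D (degree p)"
  have eval: "poly r x = (\<Sum>i\<le>D'. coeff r i * x ^ i)" if "degree r \<le> D'" for r :: "real poly" and x
    unfolding poly_altdef by (rule sum.mono_neutral_left) (use that in \<open>auto simp: coeff_eq_0\<close>)
  have "degree (P n) \<le> D'" for n using D[of n] by (simp add: D'_def)
  then have 1: "poly (P n) (t n) = (\<Sum>i\<le>D'. coeff (P n) i * t n ^ i)" for n by (rule eval)
  have 2: "poly p y = (\<Sum>i\<le>D'. coeff p i * y ^ i)" by (rule eval) (simp add: D'_def)
  show ?thesis
    unfolding 1 2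
    by (intro tendsto_sum tendsto_mult tendsto_power assms(2) tracking_tendsto[OF T] tracking_poly_coeff[OF assms(1)])
qed

lemma tracking_poly_coeffs_zero_eventually:
  assumes "(p, P) \<in> tracking_poly T" "\<And>i. k \<le> i \<Longrightarrow> coeff p i = 0"
  shows "\<forall>\<^sub>F n in sequentially. \<forall>i\<ge>k. coeff (P n) i = 0"
proof -
  obtain D where D: "\<And>n. degree (P n) \<le> D" using assms(1) by (auto simp: tracking_poly_def)
  have "\<forall>\<^sub>F n in sequentially. \<forall>i\<in>{k..D}. coeff (P n) i = 0"
  proof (intro eventually_ball_finite ballI)
    fix i assume "i \<in> {k..D}"
    then show "\<forall>\<^sub>F n in sequentially. coeff (P n) i = 0"
      using tracking_poly_coeff[OF assms(1), of i] assms(2)[of i]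
      by (intro tracking_zero_eventually[OF T]) simp
  qed simp
  then show ?thesis
  proof eventually_elim
    case (elim n)
    have "coeff (P n) i = 0" if "\<not> i \<le> D" for i
      using D[of n] that by (intro coeff_eq_0) simp
    then show ?case using elim by (metis atLeastAtMost_iff)
  qed
qed

lemma tracking_poly_zero_eventually:
  assumes "(0, P) \<in> tracking_poly T"
  shows "\<forall>\<^sub>F n in sequentially. P n = 0"
proof -
  have "\<forall>\<^sub>F n in sequentially. \<forall>i\<ge>0. coeff (P n) i = 0"
    by (rule tracking_poly_coeffs_zero_eventually[OF assms]) simp
  then show ?thesis by eventually_elim (simp add: poly_eq_iff)
qed

text \<open>\<open>T'\<close> is the ring generated by \<open>T\<close> and \<open>(y, t)\<close>.
  Sums, products and limits carry over; that zeros persist is what \<open>zero\<close> has to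
  supply.\<close>

lemma tracking_extend:
  assumes t: "t \<longlonglongrightarrow> y"
    and zero: "\<And>p P. (p, P) \<in> tracking_poly T \<Longrightarrow> poly p y = 0 \<Longrightarrow>
      \<forall>\<^sub>F n in sequentially. poly (P n) (t n) = 0"
  shows "\<exists>T'. tracking T' \<and> T \<subseteq> T' \<and> (y, t) \<in> T'"
proof -
  define T' where "T' = (\<lambda>(p, P). (poly p y, \<lambda>n. poly (P n) (t n))) ` tracking_poly T"
  have I: "(poly p y, \<lambda>n. poly (P n) (t n)) \<in> T'" if "(p, P) \<in> tracking_poly T" for p P
    using that by (force simp: T'_def)
  have E: "\<exists>p P. (p, P) \<in> tracking_poly T \<and> a = poly p y \<and> s = (\<lambda>n. poly (P n) (t n))"
    if "(a, s) \<in> T'" for a s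
    using that by (auto simp: T'_def)
  have "(a, s) \<in> T'" if "(a, s) \<in> T" for a s
    using I[OF tracking_poly_const[OF that]] by simp
  then have sub: "T \<subseteq> T'" by auto
  moreover have "(y, t) \<in> T'" using I[OF tracking_poly_monom[of 1]] by (simp add: poly_monom)
  moreover have "tracking T'"
    unfolding tracking_def
  proof (intro conjI allI impI)
    show "(1, \<lambda>n. 1) \<in> T'" using sub tracking_one[OF T] by blast
  next
    fix a s b u assume "(a, s) \<in> T' \<and> (b, u) \<in> T'"
    then obtain p P q Q where *: "(p, P) \<in> tracking_poly T" "a = poly p y" "s = (\<lambda>n. poly (P n) (t n))"
      "(q, Q) \<in> tracking_poly T" "b = poly q y" "u = (\<lambda>n. poly (Q n) (t n))"
      using E by meson
    show "(a + b, \<lambda>n. s n + u n) \<in> T'" "(a - b, \<lambda>n. s n - u n) \<in> T'" "(a * b, \<lambda>n. s n * u n) \<in> T'"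
      using I[OF tracking_poly_add[OF *(1,4)]] I[OF tracking_poly_diff[OF *(1,4)]]
        I[OF tracking_poly_mult[OF *(1,4)]] by (simp_all add: *)
  next
    fix a s assume "(a, s) \<in> T'"
    then show "s \<longlonglongrightarrow> a" using E tracking_poly_tendsto t by blast
  next
    fix s assume "(0, s) \<in> T'"
    then show "\<forall>\<^sub>F n in sequentially. s n = 0" using E zero by metis
  qed
  ultimately show ?thesis by blast
qed

text \<open>Every relation of \<open>y\<close> has \<open>p = 0\<close>, hence
  \<open>P n = 0\<close> eventually, which vanishes at any argument. Any sequence tending to
  \<open>y\<close> would therefore do.\<close>

lemma tracking_transcendental:
  assumes "\<And>p P. (p, P) \<in> tracking_poly T \<Longrightarrow> poly p y = 0 \<Longrightarrow> p = 0"
  shows "\<exists>T' t. tracking T' \<and> T \<subseteq> T' \<and> (y, t) \<in> T'"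
proof -
  have "\<forall>\<^sub>F n in sequentially. poly (P n) y = 0" if "(p, P) \<in> tracking_poly T" "poly p y = 0" for p P
  proof -
    have "(0, P) \<in> tracking_poly T" using assms[OF that] that(1) by simp
    from tracking_poly_zero_eventually[OF this] show ?thesis by eventually_elim simp
  qed
  then show ?thesis using tracking_extend[of "\<lambda>n. y" y] by auto
qed

text \<open>At a simple root the polynomial changes sign, and a sign change is stable under small
  changes of the coefficients.\<close>

lemma simple_root_tracks:
  assumes m: "(m, M) \<in> tracking_poly T" "poly m y = 0" "poly (pderiv m) y \<noteq> 0"
  shows "\<exists>t. t \<longlonglongrightarrow> y \<and> (\<forall>\<^sub>F n in sequentially. poly (M n) (t n) = 0)"
proof -
  have sign_change: "\<exists>a b. y - e < a \<and> a < b \<and> b < y + e \<and> poly m a * poly m b < 0" if "e > 0" for e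
  proof -
    have D: "DERIV (poly m) y :> poly (pderiv m) y" by (rule poly_DERIV)
    show ?thesis
    proof (cases "poly (pderiv m) y > 0")
      case True
      obtain d1 where d1: "d1 > 0" "\<And>h. 0 < h \<Longrightarrow> h < d1 \<Longrightarrow> poly m y < poly m (y + h)"
        using DERIV_pos_inc_right[OF D True] by auto
      obtain d2 where d2: "d2 > 0" "\<And>h. 0 < h \<Longrightarrow> h < d2 \<Longrightarrow> poly m (y - h) < poly m y"
        using DERIV_pos_inc_left[OF D True] by auto
      define h where "h = min e (min d1 d2) / 2"
      have "0 < h" "h < d1" "h < d2" "h < e" using d1 d2 that by (auto simp: h_def)
      then show ?thesis using d1(2)[of h] d2(2)[of h] m(2)
        by (intro exI[of _ "y - h"] exI[of _ "y + h"]) (auto simp: mult_neg_pos)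
    next
      case False
      then have neg: "poly (pderiv m) y < 0" using m(3) by simp
      obtain d1 where d1: "d1 > 0" "\<And>h. 0 < h \<Longrightarrow> h < d1 \<Longrightarrow> poly m y > poly m (y + h)"
        using DERIV_neg_dec_right[OF D neg] by auto
      obtain d2 where d2: "d2 > 0" "\<And>h. 0 < h \<Longrightarrow> h < d2 \<Longrightarrow> poly m (y - h) > poly m y"
        using DERIV_neg_dec_left[OF D neg] by auto
      define h where "h = min e (min d1 d2) / 2"
      have "0 < h" "h < d1" "h < d2" "h < e" using d1 d2 that by (auto simp: h_def)
      then show ?thesis using d1(2)[of h] d2(2)[of h] m(2)
        by (intro exI[of _ "y - h"] exI[of _ "y + h"]) (auto simp: mult_pos_neg)
    qed
  qed
  have root: "\<forall>\<^sub>F n in sequentially. \<exists>r. \<bar>r - y\<bar> < e \<and> poly (M n) r = 0" if e: "e > 0" for e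
  proof -
    obtain a b where ab: "y - e < a" "a < b" "b < y + e" "poly m a * poly m b < 0"
      using sign_change[OF e] by blast
    have "(\<lambda>n. poly (M n) a * poly (M n) b) \<longlonglongrightarrow> poly m a * poly m b"
      by (intro tendsto_mult tracking_poly_tendsto m(1) tendsto_const)
    then have "\<forall>\<^sub>F n in sequentially. poly (M n) a * poly (M n) b < 0"
      using ab(4) by (rule order_tendstoD)
    then show ?thesis
    proof eventually_elim
      case (elim n)
      then obtain r where "a < r" "r < b" "poly (M n) r = 0" using poly_IVT[OF ab(2)] by blast
      then show ?case using ab by (intro exI[of _ r]) auto
    qed
  qed
  \<comment> \<open>One sequence has to serve every \<open>e\<close>. The nearest root does: if some
    root lies within \<open>e\<close> of \<open>y\<close>, so does the nearest one.\<close>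
  define t where "t n = (SOME r. poly (M n) r = 0 \<and> (\<forall>x. poly (M n) x = 0 \<longrightarrow> dist y r \<le> dist y x))" for n
  have nearest: "poly (M n) (t n) = 0 \<and> (\<forall>x. poly (M n) x = 0 \<longrightarrow> dist y (t n) \<le> dist y x)"
    if r: "poly (M n) r = 0" for n r
  proof -
    have "closed {x. poly (M n) x = 0}" by (intro closed_Collect_eq continuous_intros)
    then obtain r' where "r' \<in> {x. poly (M n) x = 0}" "\<And>x. x \<in> {x. poly (M n) x = 0} \<Longrightarrow> dist y r' \<le> dist y x"
      using distance_attains_inf[of "{x. poly (M n) x = 0}" y] r by blast
    then show ?thesis unfolding t_def by (intro someI_ex[of "\<lambda>r. poly (M n) r = 0 \<and> (\<forall>x. poly (M n) x = 0 \<longrightarrow> dist y r \<le> dist y x)"]) auto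
  qed
  have "t \<longlonglongrightarrow> y"
  proof (rule tendstoI)
    fix e :: real assume "e > 0"
    from root[OF this] show "\<forall>\<^sub>F n in sequentially. dist (t n) y < e"
    proof eventually_elim
      case (elim n)
      then obtain r where r: "\<bar>r - y\<bar> < e" "poly (M n) r = 0" by blast
      then have "dist y (t n) \<le> dist y r" using nearest by blast
      then show ?case using r(1) by (simp add: dist_real_def abs_minus_commute)
    qed
  qed
  moreover have "\<forall>\<^sub>F n in sequentially. poly (M n) (t n) = 0"
    using root[of 1] nearest by (auto elim: eventually_mono)
  ultimately show ?thesis by blast
qed

text \<open>A polynomial over \<open>T\<close> of minimal degree with root \<open>y\<close> has \<open>y\<close> as a simple root, and
  pseudo-division by it reduces every other relation of \<open>y\<close> over \<open>T\<close>.\<close>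

lemma tracking_algebraic:
  assumes "(p0, P0) \<in> tracking_poly T" "poly p0 y = 0" "p0 \<noteq> 0"
  shows "\<exists>T' t. tracking T' \<and> T \<subseteq> T' \<and> (y, t) \<in> T'"
proof -
  define R where "R = (\<lambda>(p, P). (p, P) \<in> tracking_poly T \<and> poly p y = 0 \<and> p \<noteq> 0)"
  define mM where "mM = arg_min (\<lambda>(p, P). degree p) R"
  obtain m M where mM': "mM = (m, M)" by (cases mM)
  have "R (p0, P0)" using assms by (simp add: R_def)
  note min = arg_min_nat_lemma[of R, OF this, of "\<lambda>(p, P). degree p", folded mM_def, unfolded mM']
  have m: "(m, M) \<in> tracking_poly T" "poly m y = 0" "m \<noteq> 0" using min by (auto simp: R_def)
  have minimal: "p = 0" if "(p, P) \<in> tracking_poly T" "poly p y = 0" "degree p < degree m" for p P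
    using min that by (force simp: R_def)
  define d where "d = degree m"
  have "d > 0" using m(2,3) unfolding d_def by (cases "degree m = 0") (auto elim: degree_eq_zeroE)
  \<comment> \<open>The derivative is nonzero and of smaller degree, so by minimality it cannot
    vanish at \<open>y\<close>.\<close>
  have "degree (pderiv m) < degree m" using \<open>d > 0\<close> by (simp add: degree_pderiv d_def)
  moreover have "pderiv m \<noteq> 0" using \<open>d > 0\<close> by (simp add: pderiv_eq_0_iff d_def)
  ultimately have simple: "poly (pderiv m) y \<noteq> 0" using minimal[OF tracking_poly_pderiv[OF m(1)]] by blast
  obtain t where t: "t \<longlonglongrightarrow> y" "\<forall>\<^sub>F n in sequentially. poly (M n) (t n) = 0"
    using simple_root_tracks[OF m(1,2) simple] by blast
  have "lead_coeff m \<noteq> 0" using m(3) by simp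
  then have lead: "\<forall>\<^sub>F n in sequentially. coeff (M n) d \<noteq> 0"
    using tracking_tendsto[OF T tracking_poly_coeff[OF m(1), of d]] unfolding d_def
    by (rule tendsto_imp_eventually_ne[rotated])
  have "\<forall>\<^sub>F n in sequentially. poly (P n) (t n) = 0" if "(p, P) \<in> tracking_poly T" "poly p y = 0" for p P
    using that
  proof (induction "degree p" arbitrary: p P rule: less_induct)
    case less
    show ?case
    proof (cases "p = 0")
      case True
      then have "\<forall>\<^sub>F n in sequentially. P n = 0" using less.prems by (intro tracking_poly_zero_eventually) simp
      then show ?thesis by eventually_elim simp
    next
      case False
      then have ge: "d \<le> degree p" using minimal[OF less.prems] by (force simp: d_def)
      define k where "k = degree p - d"
      \<comment> \<open>One step of pseudo-division. The coefficients of \<open>P n\<close> and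
        \<open>M n\<close> are taken at the degrees of \<open>p\<close> and \<open>m\<close>, since
        \<open>T\<close> pairs coefficients at fixed indices.\<close>
      define p' where "p' = [:lead_coeff m:] * p - [:lead_coeff p:] * (monom 1 k * m)"
      define P' where "P' n = [:coeff (M n) d:] * P n - [:coeff (P n) (degree p):] * (monom 1 k * M n)" for n
      have mem: "(p', P') \<in> tracking_poly T"
        unfolding p'_def P'_def[abs_def] d_def
        by (intro tracking_poly_diff tracking_poly_mult tracking_poly_const tracking_poly_coeff
            tracking_poly_monom less.prems m(1))
      have root': "poly p' y = 0" using less.prems(2) m(2) by (simp add: p'_def)
      have "degree p' < degree p"
      proof (rule degree_lessI)
        show "p' \<noteq> 0 \<or> 0 < degree p" using ge \<open>d > 0\<close> by simp
        show "\<forall>i\<ge>degree p. coeff p' i = 0"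
        proof (intro allI impI)
          fix i assume i: "degree p \<le> i"
          show "coeff p' i = 0"
          proof (cases "i = degree p")
            case True
            then show ?thesis using ge by (simp add: p'_def coeff_monom_mult k_def d_def)
          next
            case False
            then have "coeff p i = 0" "coeff m (i - k) = 0"
              using i ge by (auto simp: k_def d_def intro!: coeff_eq_0)
            then show ?thesis by (simp add: p'_def coeff_monom_mult)
          qed
        qed
      qed
      \<comment> \<open>Both \<open>P' n\<close> and \<open>M n\<close> vanish at
        \<open>t n\<close>, hence so does \<open>P n\<close> times the nonzero number
        \<open>coeff (M n) d\<close>.\<close>
      from less.hyps[OF this mem root'] t(2) lead show ?thesis
        by eventually_elim (simp add: P'_def)
    qed
  qed
  then show ?thesis using tracking_extend[OF t(1)] by blast
qed

lemma tracking_adjoin: "\<exists>T' t. tracking T' \<and> T \<subseteq> T' \<and> (y, t) \<in> T'"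
  using tracking_transcendental[of y] tracking_algebraic[of _ _ y] by blast

end

lemma tracking_adjoin_finite:
  assumes "finite Y" "tracking T"
  shows "\<exists>T'. tracking T' \<and> T \<subseteq> T' \<and> (\<forall>y\<in>Y. \<exists>t. (y, t) \<in> T')"
  using assms
proof (induction Y)
  case (insert y Y)
  then obtain T1 where T1: "tracking T1" "T \<subseteq> T1" "\<forall>y\<in>Y. \<exists>t. (y, t) \<in> T1" by blast
  obtain T2 t where "tracking T2" "T1 \<subseteq> T2" "(y, t) \<in> T2" using tracking_adjoin[OF T1(1)] by blast
  then show ?case using T1 by blast
qed blast

subsection \<open>Polynomials over the rationals\<close>

definition eval_monom :: "('v \<Rightarrow>\<^sub>0 nat) \<Rightarrow> ('v \<Rightarrow> real) \<Rightarrow> real" where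
  "eval_monom m x = (\<Prod>v\<in>Poly_Mapping.keys m. x v ^ Poly_Mapping.lookup m v)"

lemma eval_poly_eval_monom:
  "eval_poly P x = (\<Sum>m\<in>Poly_Mapping.keys P. of_rat (Poly_Mapping.lookup P m) * eval_monom m x)"
  by (simp add: eval_poly_def eval_monom_def)

lemma eval_monom_superset:
  assumes "finite S" "Poly_Mapping.keys m \<subseteq> S"
  shows "eval_monom m x = (\<Prod>v\<in>S. x v ^ Poly_Mapping.lookup m v)"
  unfolding eval_monom_def
  by (rule prod.mono_neutral_left) (use assms in \<open>auto simp: in_keys_iff\<close>)

lemma eval_monom_add: "eval_monom (m + m') x = eval_monom m x * eval_monom m' x"
proof -
  let ?S = "Poly_Mapping.keys m \<union> Poly_Mapping.keys m'"
  show ?thesis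
    using eval_monom_superset[of ?S "m + m'" x] eval_monom_superset[of ?S m x]
      eval_monom_superset[of ?S m' x] Poly_Mapping.keys_add[of m m']
    by (simp add: lookup_add power_add prod.distrib)
qed

lemma eval_monom_times: "eval_monom m (\<lambda>v. x v * y v) = eval_monom m x * eval_monom m y"
  by (simp add: eval_monom_def power_mult_distrib prod.distrib)

lemma eval_poly_superset:
  assumes "finite S" "Poly_Mapping.keys P \<subseteq> S"
  shows "eval_poly P x = (\<Sum>m\<in>S. of_rat (Poly_Mapping.lookup P m) * eval_monom m x)"
  unfolding eval_poly_eval_monom
  by (rule sum.mono_neutral_left) (use assms in \<open>auto simp: in_keys_iff\<close>)

lemma eval_poly_add: "eval_poly (P + Q) x = eval_poly P x + eval_poly Q x"
proof -
  let ?S = "Poly_Mapping.keys P \<union> Poly_Mapping.keys Q"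
  show ?thesis
    using eval_poly_superset[of ?S "P + Q" x] eval_poly_superset[of ?S P x]
      eval_poly_superset[of ?S Q x] Poly_Mapping.keys_add[of P Q]
    by (simp add: lookup_add of_rat_add distrib_right sum.distrib)
qed

lemma eval_poly_diff: "eval_poly (P - Q) x = eval_poly P x - eval_poly Q x"
  using eval_poly_add[of "P - Q" Q x] by simp

lemma eval_poly_0 [simp]: "eval_poly 0 x = 0"
  by (simp add: eval_poly_def)

lemma eval_poly_sum: "eval_poly (sum f A) x = (\<Sum>a\<in>A. eval_poly (f a) x)"
  by (induction A rule: infinite_finite_induct) (auto simp: eval_poly_add)

lemma eval_poly_single: "eval_poly (Poly_Mapping.single m c) x = of_rat c * eval_monom m x"
  using eval_poly_superset[of "{m}" "Poly_Mapping.single m c" x] by simp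

lemma poly_mapping_sum_single: "P = (\<Sum>m\<in>Poly_Mapping.keys P. Poly_Mapping.single m (Poly_Mapping.lookup P m))"
proof (rule poly_mapping_eqI)
  fix k
  have "(\<Sum>m\<in>Poly_Mapping.keys P. Poly_Mapping.lookup P m when m = k) = Poly_Mapping.lookup P k"
    by (cases "k \<in> Poly_Mapping.keys P") (auto simp: when_def in_keys_iff)
  then show "Poly_Mapping.lookup P k = Poly_Mapping.lookup (\<Sum>m\<in>Poly_Mapping.keys P. Poly_Mapping.single m (Poly_Mapping.lookup P m)) k"
    by (simp add: lookup_sum lookup_single)
qed

lemma eval_poly_mult: "eval_poly (P * Q) x = eval_poly P x * eval_poly Q x"
proof -
  have "P * Q = (\<Sum>m\<in>Poly_Mapping.keys P. \<Sum>m'\<in>Poly_Mapping.keys Q.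
      Poly_Mapping.single (m + m') (Poly_Mapping.lookup P m * Poly_Mapping.lookup Q m'))"
    by (subst (1) poly_mapping_sum_single[of P], subst (1) poly_mapping_sum_single[of Q])
      (simp add: sum_product mult_single)
  then show ?thesis
    by (simp add: eval_poly_sum eval_poly_single eval_monom_add of_rat_mult)
      (simp add: eval_poly_eval_monom sum_product algebra_simps)
qed

definition poly_over :: "'v set \<Rightarrow> (('v \<Rightarrow>\<^sub>0 nat) \<Rightarrow>\<^sub>0 rat) set" where
  "poly_over I = {P. \<forall>m\<in>Poly_Mapping.keys P. Poly_Mapping.keys m \<subseteq> I}"

lemma poly_overD:
  "P \<in> poly_over I \<Longrightarrow> m \<in> Poly_Mapping.keys P \<Longrightarrow> v \<in> Poly_Mapping.keys m \<Longrightarrow> v \<in> I"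
  by (auto simp: poly_over_def)

lemma eval_poly_cong:
  assumes "P \<in> poly_over I" "\<And>v. v \<in> I \<Longrightarrow> x v = y v"
  shows "eval_poly P x = eval_poly P y"
  unfolding eval_poly_def using assms
  by (intro sum.cong arg_cong2[where f = "(*)"] prod.cong refl) (auto dest: poly_overD)

lemma poly_over_add: "P \<in> poly_over I \<Longrightarrow> Q \<in> poly_over I \<Longrightarrow> P + Q \<in> poly_over I"
  using Poly_Mapping.keys_add[of P Q] by (auto simp: poly_over_def subset_iff)

lemma keys_uminus_rat: "Poly_Mapping.keys (- P) = Poly_Mapping.keys P" for P :: "'a \<Rightarrow>\<^sub>0 rat"
  by (auto simp: in_keys_iff)

lemma poly_over_diff: "P \<in> poly_over I \<Longrightarrow> Q \<in> poly_over I \<Longrightarrow> P - Q \<in> poly_over I"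
  using poly_over_add[of P I "- Q"] by (simp add: poly_over_def keys_uminus_rat)

lemma poly_over_mult:
  assumes "P \<in> poly_over I" "Q \<in> poly_over I"
  shows "P * Q \<in> poly_over I"
  unfolding poly_over_def
proof (intro CollectI ballI)
  fix m assume "m \<in> Poly_Mapping.keys (P * Q)"
  then obtain a b where "m = a + b" "a \<in> Poly_Mapping.keys P" "b \<in> Poly_Mapping.keys Q"
    using keys_mult[of P Q] by blast
  then show "Poly_Mapping.keys m \<subseteq> I"
    using Poly_Mapping.keys_add[of a b] assms by (auto simp: poly_over_def subset_iff)
qed

text \<open>Closure properties then recognize functions such as determinants as rational
  polynomials, without exhibiting the polynomial.\<close>

definition rat_polynomial :: "'v set \<Rightarrow> (('v \<Rightarrow> real) \<Rightarrow> real) \<Rightarrow> bool" where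
  "rat_polynomial I f \<longleftrightarrow> (\<exists>P\<in>poly_over I. f = eval_poly P)"

lemma rat_polynomial_of_rat: "rat_polynomial I (\<lambda>x. of_rat c)"
  unfolding rat_polynomial_def
  by (rule bexI[of _ "Poly_Mapping.single 0 c"])
    (auto simp: poly_over_def eval_poly_single eval_monom_def fun_eq_iff)

lemma rat_polynomial_of_int: "rat_polynomial I (\<lambda>x. of_int c)"
  using rat_polynomial_of_rat[of I "of_int c"] by simp

lemma rat_polynomial_var: "v \<in> I \<Longrightarrow> rat_polynomial I (\<lambda>x. x v)"
  unfolding rat_polynomial_def
  by (rule bexI[of _ "Poly_Mapping.single (Poly_Mapping.single v 1) 1"])
    (auto simp: poly_over_def eval_poly_single eval_monom_def fun_eq_iff)

lemma rat_polynomial_add: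
  "rat_polynomial I f \<Longrightarrow> rat_polynomial I g \<Longrightarrow> rat_polynomial I (\<lambda>x. f x + g x)"
  unfolding rat_polynomial_def
proof (elim bexE)
  fix P Q assume "P \<in> poly_over I" "f = eval_poly P" "Q \<in> poly_over I" "g = eval_poly Q"
  then show "\<exists>R\<in>poly_over I. (\<lambda>x. f x + g x) = eval_poly R"
    by (intro bexI[of _ "P + Q"] poly_over_add) (auto simp: eval_poly_add)
qed

lemma rat_polynomial_diff:
  "rat_polynomial I f \<Longrightarrow> rat_polynomial I g \<Longrightarrow> rat_polynomial I (\<lambda>x. f x - g x)"
  unfolding rat_polynomial_def
proof (elim bexE)
  fix P Q assume "P \<in> poly_over I" "f = eval_poly P" "Q \<in> poly_over I" "g = eval_poly Q"
  then show "\<exists>R\<in>poly_over I. (\<lambda>x. f x - g x) = eval_poly R"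
    by (intro bexI[of _ "P - Q"] poly_over_diff) (auto simp: eval_poly_diff)
qed

lemma rat_polynomial_mult:
  "rat_polynomial I f \<Longrightarrow> rat_polynomial I g \<Longrightarrow> rat_polynomial I (\<lambda>x. f x * g x)"
  unfolding rat_polynomial_def
proof (elim bexE)
  fix P Q assume "P \<in> poly_over I" "f = eval_poly P" "Q \<in> poly_over I" "g = eval_poly Q"
  then show "\<exists>R\<in>poly_over I. (\<lambda>x. f x * g x) = eval_poly R"
    by (intro bexI[of _ "P * Q"] poly_over_mult) (auto simp: eval_poly_mult)
qed

lemma rat_polynomial_sum:
  "(\<And>a. a \<in> A \<Longrightarrow> rat_polynomial I (f a)) \<Longrightarrow> rat_polynomial I (\<lambda>x. \<Sum>a\<in>A. f a x)"
  by (induction A rule: infinite_finite_induct)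
    (use rat_polynomial_of_int[of I 0] in \<open>auto intro: rat_polynomial_add\<close>)

lemma rat_polynomial_prod:
  "(\<And>a. a \<in> A \<Longrightarrow> rat_polynomial I (f a)) \<Longrightarrow> rat_polynomial I (\<lambda>x. \<Prod>a\<in>A. f a x)"
  by (induction A rule: infinite_finite_induct)
    (use rat_polynomial_of_int[of I 1] in \<open>auto intro: rat_polynomial_mult\<close>)

lemma algebraically_independent_rat_polynomial:
  assumes "algebraically_independent_over_rat I p" "rat_polynomial I f" "f p = 0"
  shows "f x = 0"
proof -
  obtain P where "P \<in> poly_over I" "f = eval_poly P" using assms(2) by (auto simp: rat_polynomial_def)
  moreover from this have "P = 0" using assms(1,3)
    by (auto simp: algebraically_independent_over_rat_def poly_over_def)
  ultimately show ?thesis by simp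
qed

text \<open>Dedekind's independence of characters, applied to monomials.\<close>

lemma monomials_independent:
  assumes "finite S" "\<And>x. (\<Sum>m\<in>S. c m * eval_monom m x) = 0"
  shows "\<forall>m\<in>S. c m = 0"
  using assms
proof (induction S arbitrary: c)
  case (insert m1 S)
  have eq: "c m1 * eval_monom m1 x + (\<Sum>m\<in>S. c m * eval_monom m x) = 0" for x
    using insert.prems[of x] insert.hyps by simp
  \<comment> \<open>Comparing the relation at the pointwise product of \<open>x\<close> and
    \<open>y\<close> with a multiple of the relation at \<open>x\<close> eliminates
    \<open>m1\<close>.\<close>
  have "(\<Sum>m\<in>S. c m * (eval_monom m y - eval_monom m1 y) * eval_monom m x) = 0" for x y
  proof -
    have "c m1 * eval_monom m1 x * eval_monom m1 y
        + (\<Sum>m\<in>S. c m * eval_monom m x * eval_monom m y) = 0"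
      using eq[of "\<lambda>v. x v * y v"] by (simp add: eval_monom_times algebra_simps)
    moreover have "eval_monom m1 y * (c m1 * eval_monom m1 x)
        + eval_monom m1 y * (\<Sum>m\<in>S. c m * eval_monom m x) = 0"
      using eq[of x] by (metis distrib_left mult_zero_right)
    ultimately show ?thesis
      by (simp add: sum_subtractf sum_distrib_left algebra_simps)
  qed
  from insert.IH[OF this] have z: "c m * (eval_monom m y - eval_monom m1 y) = 0" if "m \<in> S" for m y
    using that by blast
  have "c m = 0" if "m \<in> S" for m
  proof -
    have "m \<noteq> m1" using that insert.hyps by auto
    then obtain v where v: "Poly_Mapping.lookup m v \<noteq> Poly_Mapping.lookup m1 v"
      by (meson poly_mapping_eqI)
    \<comment> \<open>Distinct exponents of \<open>v\<close> give distinct powers of 2.\<close>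
    define y :: "'a \<Rightarrow> real" where "y = (\<lambda>_. 1)(v := 2)"
    have "eval_monom k y = 2 ^ Poly_Mapping.lookup k v" for k
    proof -
      have "eval_monom k y = (\<Prod>w\<in>insert v (Poly_Mapping.keys k). y w ^ Poly_Mapping.lookup k w)"
        by (rule eval_monom_superset) auto
      moreover have "(\<Prod>w\<in>Poly_Mapping.keys k - {v}. y w ^ Poly_Mapping.lookup k w) = 1"
        by (rule prod.neutral) (auto simp: y_def)
      ultimately show ?thesis by (simp add: prod.insert_remove) (simp add: y_def)
    qed
    then show ?thesis using z[OF that, of y] v by simp
  qed
  moreover from this have "c m1 = 0" using eq[of "\<lambda>_. 1"] by (simp add: eval_monom_def)
  ultimately show ?case by simp
qed simp

lemma eval_poly_nonzero:
  assumes "P \<noteq> 0"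
  shows "\<exists>x. eval_poly P x \<noteq> 0"
proof (rule ccontr)
  assume "\<not> ?thesis"
  then have "\<forall>m\<in>Poly_Mapping.keys P. real_of_rat (Poly_Mapping.lookup P m) = 0"
    by (intro monomials_independent) (auto simp: eval_poly_eval_monom)
  then have "P = 0" by (intro poly_mapping_eqI) (auto simp: in_keys_iff)
  then show False using assms by simp
qed

lemma eval_poly_line:
  "\<exists>q. \<forall>t. eval_poly P (\<lambda>v. a v + t * b v) = poly q t"
  by (rule exI[of _ "\<Sum>m\<in>Poly_Mapping.keys P. smult (of_rat (Poly_Mapping.lookup P m))
      (\<Prod>v\<in>Poly_Mapping.keys m. [:a v, b v:] ^ Poly_Mapping.lookup m v)"])
    (simp add: eval_poly_def poly_sum poly_prod poly_power)

text \<open>A rational polynomial that vanishes at \<open>p\<close> vanishes identically by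
  independence, so here zeros persist for every \<open>n\<close>, along any convergent
  sequence.\<close>

lemma tracking_base:
  assumes indep: "algebraically_independent_over_rat I p"
    and lim: "\<And>v. v \<in> I \<Longrightarrow> (\<lambda>n. x n v) \<longlonglongrightarrow> p v"
  shows "\<exists>T. tracking T \<and> (\<forall>v\<in>I. (p v, \<lambda>n. x n v) \<in> T)"
proof -
  define T where "T = {(f p, \<lambda>n. f (x n)) | f. rat_polynomial I f}"
  have TI: "(f p, \<lambda>n. f (x n)) \<in> T" if "rat_polynomial I f" for f
    using that by (auto simp: T_def)
  have "f p = 0 \<Longrightarrow> f (x n) = 0" if "rat_polynomial I f" for f n
    using algebraically_independent_rat_polynomial[OF indep that] by blast
  moreover have "(\<lambda>n. f (x n)) \<longlonglongrightarrow> f p" if f: "rat_polynomial I f" for f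
  proof -
    obtain P where P: "P \<in> poly_over I" "f = eval_poly P" using f by (auto simp: rat_polynomial_def)
    show ?thesis
      unfolding P(2) eval_poly_def
      by (intro tendsto_sum tendsto_mult tendsto_const tendsto_prod tendsto_power lim)
        (use P(1) in \<open>auto dest: poly_overD\<close>)
  qed
  moreover have "(1, \<lambda>n. 1) \<in> T"
    using TI[OF rat_polynomial_of_int[of I 1]] by simp
  moreover have "(f p + g p, \<lambda>n. f (x n) + g (x n)) \<in> T \<and> (f p - g p, \<lambda>n. f (x n) - g (x n)) \<in> T \<and>
      (f p * g p, \<lambda>n. f (x n) * g (x n)) \<in> T" if "rat_polynomial I f" "rat_polynomial I g" for f g
    using TI[OF rat_polynomial_add[OF that]] TI[OF rat_polynomial_diff[OF that]]
      TI[OF rat_polynomial_mult[OF that]] by simp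
  ultimately have "tracking T" unfolding tracking_def by (auto simp: T_def)
  moreover have "(p v, \<lambda>n. x n v) \<in> T" if "v \<in> I" for v
    using TI[OF rat_polynomial_var[OF that]] .
  ultimately show ?thesis by blast
qed

text \<open>A finitely supported function is determined by its graph over its keys, a finite set of
  pairs.\<close>

lemma countable_poly_mapping:
  assumes "countable (UNIV :: 'a set)" "countable (UNIV :: 'b::zero set)"
  shows "countable (UNIV :: ('a \<Rightarrow>\<^sub>0 'b) set)"
proof -
  define g :: "('a \<Rightarrow>\<^sub>0 'b) \<Rightarrow> ('a \<times> 'b) set" where
    "g P = (\<lambda>a. (a, Poly_Mapping.lookup P a)) ` Poly_Mapping.keys P" for P
  have mem: "(a, b) \<in> g P \<longleftrightarrow> b \<noteq> 0 \<and> Poly_Mapping.lookup P a = b" for a b P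
    by (auto simp: g_def in_keys_iff)
  have "inj g"
  proof (rule injI, rule poly_mapping_eqI)
    fix P Q k assume "g P = g Q"
    then show "Poly_Mapping.lookup P k = Poly_Mapping.lookup Q k" using mem by metis
  qed
  moreover have "countable (UNIV :: ('a \<times> 'b) set)"
    using countable_SIGMA[OF assms(1), of "\<lambda>_. UNIV"] assms(2) by simp
  then have "countable {A :: ('a \<times> 'b) set. finite A \<and> A \<subseteq> UNIV}" by (rule countable_Collect_finite_subset)
  then have "countable (range g)" by (rule countable_subset[rotated]) (auto simp: g_def)
  ultimately show ?thesis using countable_image_inj_on by blast
qed

subsection \<open>Zero sets of polynomials in product measures\<close>

text \<open>Fubini for null sets. The new coordinate is in the outer integral, so it can be fixed
  before the others are considered.\<close>

lemma AE_PiM_insert: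
  assumes "product_sigma_finite M" "finite I" "i \<notin> I"
    and meas: "{x \<in> space (PiM (insert i I) M). P x} \<in> sets (PiM (insert i I) M)"
    and ae: "AE y in M i. AE x in PiM I M. P (x(i := y))"
  shows "AE x in PiM (insert i I) M. P x"
proof -
  interpret product_sigma_finite M by fact
  define N where "N = space (PiM (insert i I) M) - {x \<in> space (PiM (insert i I) M). P x}"
  have N: "N \<in> sets (PiM (insert i I) M)" unfolding N_def using meas by blast
  have "emeasure (PiM (insert i I) M) N = (\<integral>\<^sup>+ x. indicator N x \<partial>PiM (insert i I) M)"
    using N by simp
  also have "\<dots> = (\<integral>\<^sup>+ y. (\<integral>\<^sup>+ x. indicator N (x(i := y)) \<partial>PiM I M) \<partial>M i)"
    using N assms(2,3) by (intro product_nn_integral_insert_rev) auto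
  also have "\<dots> = (\<integral>\<^sup>+ y. 0 \<partial>M i)"
  proof (rule nn_integral_cong_AE, use ae in eventually_elim)
    case (elim y)
    then have "AE x in PiM I M. indicator N (x(i := y)) = (0 :: ennreal)"
      by eventually_elim (auto simp: N_def)
    then have "(\<integral>\<^sup>+ x. indicator N (x(i := y)) \<partial>PiM I M) = (\<integral>\<^sup>+ x. 0 \<partial>PiM I M)"
      by (rule nn_integral_cong_AE)
    then show ?case by simp
  qed
  finally have "N \<in> null_sets (PiM (insert i I) M)" using N by auto
  then show ?thesis by (rule AE_I') (auto simp: N_def)
qed

text \<open>A coordinate-free form of being polynomial; on the real line it leaves only finitely
  many zeros unless the function is zero.\<close>

definition polynomial_on_lines :: "('a::real_vector \<Rightarrow> real) \<Rightarrow> bool" where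
  "polynomial_on_lines f \<longleftrightarrow> (\<forall>a b. \<exists>q. \<forall>t. f (a + t *\<^sub>R b) = poly q t)"

text \<open>A condition on a single factor, so that one product theorem serves twice: for Lebesgue
  measure as a product of lines, and for the joint law of the samples.\<close>

definition thin_zero_sets :: "'a::real_vector measure \<Rightarrow> bool" where
  "thin_zero_sets M \<longleftrightarrow> (\<forall>g\<in>borel_measurable M. polynomial_on_lines g \<and> (\<exists>x. g x \<noteq> 0) \<longrightarrow>
     (AE x in M. g x \<noteq> 0))"

lemma AE_PiM_polynomial_nonzero:
  fixes M :: "'i \<Rightarrow> 'a::real_vector measure"
  assumes "product_sigma_finite M" "finite I"
    and "\<And>i. space (M i) = UNIV" "\<And>i. thin_zero_sets (M i)"
    and "f \<in> borel_measurable (PiM I M)"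
    and "\<And>a b. \<exists>q. \<forall>t. f (\<lambda>j. a j + t *\<^sub>R b j) = poly q t"
    and "x0 \<in> extensional I" "f x0 \<noteq> 0"
  shows "AE x in PiM I M. f x \<noteq> 0"
  using assms(2,5-)
proof (induction I arbitrary: f x0)
  case empty
  then have "f x \<noteq> 0" if "x \<in> space (PiM {} M)" for x
    using that by (auto simp: space_PiM PiE_def)
  then show ?case by auto
next
  case (insert i I)
  note [measurable] = insert.prems(1)
  \<comment> \<open>Off \<open>i\<close> this is \<open>x0\<close>; the value at \<open>i\<close> is
    reset to make it extensional on the smaller index set.\<close>
  define z where "z = x0(i := undefined)"
  have z: "z \<in> extensional I" using insert.prems(3) by (auto simp: z_def extensional_def)
  have zs: "z \<in> space (PiM I M)" using z assms(3) by (auto simp: space_PiM PiE_def)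
  have upd_y: "(\<lambda>y. z(i := y)) \<in> measurable (M i) (PiM (insert i I) M)"
    using zs insert.hyps by (intro measurable_component_update) auto
  have upd_x: "(\<lambda>x. x(i := y)) \<in> measurable (PiM I M) (PiM (insert i I) M)" for y
    by (rule measurable_fun_upd[where J = I]) (auto simp: assms(3))
  define g where "g y = f (z(i := y))" for y
  have "g \<in> borel_measurable (M i)"
    unfolding g_def using measurable_compose[OF upd_y insert.prems(1)] .
  moreover have "polynomial_on_lines g"
    unfolding polynomial_on_lines_def
  proof (intro allI)
    fix a b
    have "z(i := a + t *\<^sub>R b) = (\<lambda>j. (z(i := a)) j + t *\<^sub>R ((\<lambda>_. 0)(i := b)) j)" for t
      by auto
    then show "\<exists>q. \<forall>t. g (a + t *\<^sub>R b) = poly q t" unfolding g_def using insert.prems(2) by simp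
  qed
  moreover have "g (x0 i) \<noteq> 0" using insert.prems(4) by (simp add: g_def z_def)
  ultimately have "AE y in M i. g y \<noteq> 0" using assms(4)[of i] unfolding thin_zero_sets_def by blast
  then have "AE y in M i. AE x in PiM I M. f (x(i := y)) \<noteq> 0"
  proof eventually_elim
    case (elim y)
    show ?case
    proof (rule insert.IH[OF _ _ z])
      show "(\<lambda>x. f (x(i := y))) \<in> borel_measurable (PiM I M)"
        using measurable_compose[OF upd_x insert.prems(1)] .
      show "f (z(i := y)) \<noteq> 0" using elim by (simp add: g_def)
      fix a b :: "'i \<Rightarrow> 'a"
      have "(\<lambda>j. a j + t *\<^sub>R b j)(i := y) = (\<lambda>j. (a(i := y)) j + t *\<^sub>R (b(i := 0)) j)" for t
        by auto
      then show "\<exists>q. \<forall>t. f ((\<lambda>j. a j + t *\<^sub>R b j)(i := y)) = poly q t" using insert.prems(2) by simp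
    qed
  qed
  then show ?case
    using insert.hyps by (intro AE_PiM_insert[OF assms(1)]) measurable
qed

lemma thin_zero_sets_lborel_real: "thin_zero_sets (lborel :: real measure)"
  unfolding thin_zero_sets_def
proof (intro ballI impI)
  fix g :: "real \<Rightarrow> real"
  assume g: "polynomial_on_lines g \<and> (\<exists>x. g x \<noteq> 0)"
  then obtain q where q: "\<And>t. g (0 + t *\<^sub>R 1) = poly q t" unfolding polynomial_on_lines_def by meson
  have "q \<noteq> 0" using g q by auto
  then have "finite {x. poly q x = 0}" by (rule poly_roots_finite)
  then have "{x. poly q x = 0} \<in> null_sets lborel" by (rule finite_imp_null_set_lborel)
  then show "AE x in lborel. g x \<noteq> 0" by (rule AE_I') (use q in auto)
qed

lemma thin_zero_sets_lborel: "thin_zero_sets (lborel :: 'a::euclidean_space measure)"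
  unfolding thin_zero_sets_def
proof (intro ballI impI)
  fix g :: "'a \<Rightarrow> real"
  assume [measurable]: "g \<in> borel_measurable lborel" and g: "polynomial_on_lines g \<and> (\<exists>x. g x \<noteq> 0)"
  define S where "S f = (\<Sum>b\<in>Basis. f b *\<^sub>R b)" for f :: "'a \<Rightarrow> real"
  let ?P = "Pi\<^sub>M Basis (\<lambda>b :: 'a. lborel :: real measure)"
  have S[measurable]: "S \<in> measurable ?P borel" unfolding S_def by measurable
  obtain x where x: "g x \<noteq> 0" using g by blast
  have "AE f in ?P. g (S f) \<noteq> 0"
  proof (rule AE_PiM_polynomial_nonzero)
    show "product_sigma_finite (\<lambda>b :: 'a. lborel :: real measure)" by standard
    show "(\<lambda>f. g (S f)) \<in> borel_measurable ?P" by measurable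
    show "restrict (\<lambda>b. x \<bullet> b) Basis \<in> extensional Basis" by simp
    have "S (restrict (\<lambda>b. x \<bullet> b) Basis) = (\<Sum>b\<in>Basis. (x \<bullet> b) *\<^sub>R b)"
      unfolding S_def by (intro sum.cong) auto
    then show "g (S (restrict (\<lambda>b. x \<bullet> b) Basis)) \<noteq> 0" using x by (simp add: euclidean_representation)
    fix a b
    have "S (\<lambda>j. a j + t *\<^sub>R b j) = S a + t *\<^sub>R S b" for t
      by (simp add: S_def scaleR_add_left sum.distrib scaleR_sum_right)
    then show "\<exists>q. \<forall>t. g (S (\<lambda>j. a j + t *\<^sub>R b j)) = poly q t"
      using g by (simp add: polynomial_on_lines_def)
  qed (auto simp: thin_zero_sets_lborel_real)
  then show "AE x in lborel. g x \<noteq> 0"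
    unfolding lborel_eq[where 'a = 'a] S_def by (subst AE_distr_iff) measurable
qed

lemma thin_zero_sets_absolutely_continuous:
  assumes "sets \<mu> = sets borel" "absolutely_continuous (lborel :: 'a::euclidean_space measure) \<mu>"
  shows "thin_zero_sets \<mu>"
  unfolding thin_zero_sets_def
proof (intro ballI impI)
  fix g assume "g \<in> borel_measurable \<mu>" and g: "polynomial_on_lines g \<and> (\<exists>x. g x \<noteq> 0)"
  then have "g \<in> borel_measurable lborel" using measurable_cong_sets[OF assms(1) refl] by auto
  then have "AE x in lborel. g x \<noteq> 0" using g thin_zero_sets_lborel unfolding thin_zero_sets_def by blast
  then show "AE x in \<mu>. g x \<noteq> 0"
    using absolutely_continuous_AE[OF _ assms(2)] assms(1) by simp
qed

text \<open>Normalizes a strictly positive integrable density; positivity makes null sets of \<mu>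
  Lebesgue null.\<close>

lemma lebesgue_equivalent_distribution_exists:
  "\<exists>\<mu> :: (real^'n) measure. lebesgue_equivalent_distribution \<mu>"
proof -
  obtain f :: "real^'n \<Rightarrow> real" where f: "f \<in> borel_measurable lborel" "\<And>x. f x > 0" "integrable lborel f"
    using sigma_finite_measure.obtain_positive_integrable_function[OF sigma_finite_lborel] by metis
  note [measurable] = f(1)
  define c where "c = (\<integral>\<^sup>+ x. ennreal (f x) \<partial>lborel)"
  have c_fin: "c < \<infinity>" unfolding c_def using f(2,3) by (simp add: integrable_iff_bounded abs_of_pos)
  have c_pos: "c \<noteq> 0"
  proof
    assume "c = 0"
    then have "AE x in (lborel :: (real^'n) measure). ennreal (f x) = 0"
      unfolding c_def by (subst (asm) nn_integral_0_iff_AE) auto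
    then have "AE x in (lborel :: (real^'n) measure). False"
      by eventually_elim (metis ennreal_eq_0_iff f(2) not_le)
    then show False by (simp add: AE_iff_null emeasure_lborel_UNIV null_sets_def)
  qed
  define \<mu> where "\<mu> = density lborel (\<lambda>x. ennreal (f x) / c)"
  have meas: "(\<lambda>x. ennreal (f x) / c) \<in> borel_measurable (lborel :: (real^'n) measure)" by measurable
  have "emeasure \<mu> (space \<mu>) = (\<integral>\<^sup>+ x. ennreal (f x) / c \<partial>lborel)"
    by (simp add: \<mu>_def emeasure_density)
  also have "\<dots> = c / c" unfolding c_def by (simp add: nn_integral_divide)
  also have "\<dots> = 1" using c_fin c_pos by (simp add: ennreal_divide_self)
  finally have "prob_space \<mu>" by (rule prob_spaceI)
  moreover have "sets \<mu> = sets borel" by (simp add: \<mu>_def)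
  moreover have "absolutely_continuous lborel \<mu>"
    unfolding \<mu>_def by (rule absolutely_continuousI_density[OF meas])
  moreover have "absolutely_continuous \<mu> lborel"
    unfolding absolutely_continuous_def
  proof
    fix N assume "N \<in> null_sets \<mu>"
    then have N: "N \<in> sets lborel" "AE x in lborel. x \<in> N \<longrightarrow> ennreal (f x) / c = 0"
      unfolding \<mu>_def null_sets_density_iff[OF meas] by auto
    from N(2) have "AE x in lborel. x \<notin> N"
      by eventually_elim (use f(2) c_fin in \<open>auto simp: ennreal_divide_eq_0_iff dest!: ennreal_eq_0_iff[THEN iffD1] leD\<close>)
    then show "N \<in> null_sets lborel" using N(1) by (simp add: AE_iff_null_sets)
  qed
  ultimately show ?thesis unfolding lebesgue_equivalent_distribution_def by blast
qed

subsection \<open>Generic frameworks and almost all samples\<close>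

lemma generic_stressed_tracks:
  fixes p :: "'n::finite framework"
  assumes gen: "generic_framework d p"
    and str: "stressed E (insert 1 ((\<lambda>k. \<chi> i. p i k) ` {..<d}))"
    and lim: "\<And>i k. k < d \<Longrightarrow> (\<lambda>n. x n i k) \<longlonglongrightarrow> p i k"
  shows "\<forall>\<^sub>F n in sequentially. stressed E (insert 1 ((\<lambda>k. \<chi> i. x n i k) ` {..<d}))"
proof -
  obtain \<Omega> :: "real^'n^'n" where \<Omega>: "\<Omega> \<noteq> 0" "psd \<Omega>"
      "\<And>i j. i \<noteq> j \<Longrightarrow> (i, j) \<notin> E \<Longrightarrow> \<Omega> $ i $ j = 0"
      "\<Omega> *v 1 = 0" "\<And>k. k < d \<Longrightarrow> \<Omega> *v (\<chi> i. p i k) = 0"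
    using str unfolding stressed_def by auto
  obtain u where u: "\<Omega> = gram u (UNIV :: 'n set)" using psd_eq_gram[OF \<Omega>(2)] by blast
  obtain T0 where T0: "tracking T0" "\<And>i k. k < d \<Longrightarrow> (p i k, \<lambda>n. x n i k) \<in> T0"
    using tracking_base[OF gen[unfolded generic_framework_def], of "\<lambda>n (i, k). x n i k"] lim by force
  obtain T where T: "tracking T" "T0 \<subseteq> T" "\<forall>y\<in>range (\<lambda>(k, i). u k $ i). \<exists>t. (y, t) \<in> T"
    using tracking_adjoin_finite[OF _ T0(1), of "range (\<lambda>(k, i). u k $ i)"] by auto
  have "\<forall>k i. \<exists>t. (u k $ i, t) \<in> T" using T(3) by fastforce
  then obtain t where t: "\<And>k i. (u k $ i, t k i) \<in> T" by metis
  \<comment> \<open>Semidefinite for every \<open>n\<close>, whatever the continued entries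
    are.\<close>
  define W where "W n = gram (\<lambda>k. \<chi> i. t k i n) (UNIV :: 'n set)" for n
  have W: "(\<Omega> $ i $ j, \<lambda>n. W n $ i $ j) \<in> T" for i j
    unfolding u W_def gram_def by (simp, intro tracking_sum tracking_mult T(1) t)
  have pat: "\<forall>\<^sub>F n in sequentially. W n $ i $ j = 0" if "\<Omega> $ i $ j = 0" for i j
    using tracking_zero_eventually[OF T(1)] W[of i j] that by simp
  have ev1: "\<forall>\<^sub>F n in sequentially. \<forall>i j. i \<noteq> j \<and> (i, j) \<notin> E \<longrightarrow> W n $ i $ j = 0"
  proof (intro eventually_all_finite)
    fix i j show "\<forall>\<^sub>F n in sequentially. i \<noteq> j \<and> (i, j) \<notin> E \<longrightarrow> W n $ i $ j = 0"
    proof (cases "i \<noteq> j \<and> (i, j) \<notin> E")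
      case True
      then show ?thesis using pat[OF \<Omega>(3)] by (auto elim: eventually_mono)
    qed auto
  qed
  have ker: "\<forall>\<^sub>F n in sequentially. (W n *v y n) $ i = 0"
    if "\<Omega> *v v = 0" and "\<And>j. (v $ j, \<lambda>n. y n $ j) \<in> T" for v y i
  proof -
    have "(\<Sum>j\<in>UNIV. \<Omega> $ i $ j * v $ j, \<lambda>n. \<Sum>j\<in>UNIV. W n $ i $ j * y n $ j) \<in> T"
      by (intro tracking_sum tracking_mult T(1) W that(2))
    moreover have "(\<Sum>j\<in>UNIV. \<Omega> $ i $ j * v $ j) = 0"
      using that(1) by (simp add: matrix_vector_mult_def vec_eq_iff)
    ultimately show ?thesis
      using tracking_zero_eventually[OF T(1)] by (simp add: matrix_vector_mult_def)
  qed
  have "\<forall>\<^sub>F n in sequentially. \<forall>i. (W n *v 1) $ i = 0"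
    by (intro eventually_all_finite ker[OF \<Omega>(4)]) (simp add: tracking_one[OF T(1)])
  then have ev2: "\<forall>\<^sub>F n in sequentially. W n *v 1 = 0" by (simp add: vec_eq_iff)
  have "\<forall>\<^sub>F n in sequentially. \<forall>i. (W n *v (\<chi> i. x n i k)) $ i = 0" if "k < d" for k
    by (intro eventually_all_finite ker[OF \<Omega>(5)[OF that]]) (use T(2) T0(2)[OF that] in auto)
  then have "\<forall>\<^sub>F n in sequentially. W n *v (\<chi> i. x n i k) = 0" if "k < d" for k
    using that by (simp add: vec_eq_iff)
  then have ev3: "\<forall>\<^sub>F n in sequentially. \<forall>k\<in>{..<d}. W n *v (\<chi> i. x n i k) = 0"
    by (intro eventually_ball_finite) auto
  obtain a b where ab: "\<Omega> $ a $ b \<noteq> 0" using \<Omega>(1) by (auto simp: vec_eq_iff)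
  \<comment> \<open>Being nonzero is not a polynomial equation; it persists by convergence.\<close>
  have ev4: "\<forall>\<^sub>F n in sequentially. W n $ a $ b \<noteq> 0"
    by (rule tendsto_imp_eventually_ne[OF tracking_tendsto[OF T(1) W] ab])
  from ev1 ev2 ev3 ev4 show ?thesis
  proof eventually_elim
    case (elim n)
    moreover have "psd (W n)" unfolding W_def by (rule psd_gram)
    moreover have "W n \<noteq> 0" using elim(4) by auto
    ultimately show ?case unfolding stressed_def by (intro exI[of _ "W n"]) auto
  qed
qed

section \<open>Normalized samples as frameworks\<close>

lemma stressed_columns_iff:
  fixes X :: "nat \<Rightarrow> real^'n::finite"
  assumes "\<And>i. X d $ i \<noteq> 0"
  shows "stressed E (X ` {..<Suc d}) \<longleftrightarrow>
    stressed E (insert 1 ((\<lambda>k. \<chi> i. X k $ i / X d $ i) ` {..<d}))"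
proof
  assume "stressed E (X ` {..<Suc d})"
  then show "stressed E (insert 1 ((\<lambda>k. \<chi> i. X k $ i / X d $ i) ` {..<d}))"
  proof (rule stressed_rescale[where x = "\<lambda>i. X d $ i"])
    fix w assume "w \<in> insert 1 ((\<lambda>k. \<chi> i. X k $ i / X d $ i) ` {..<d})"
    then consider "w = 1" | k where "k < d" "w = (\<chi> i. X k $ i / X d $ i)" by auto
    then show "(\<chi> i. X d $ i * w $ i) \<in> X ` {..<Suc d}"
    proof cases
      case 1
      then have "(\<chi> i. X d $ i * w $ i) = X d" by (simp add: vec_eq_iff)
      then show ?thesis by auto
    next
      case 2
      then have "(\<chi> i. X d $ i * w $ i) = X k" using assms by (simp add: vec_eq_iff)
      then show ?thesis using 2 by auto
    qed
  qed (rule assms)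
next
  assume "stressed E (insert 1 ((\<lambda>k. \<chi> i. X k $ i / X d $ i) ` {..<d}))"
  then show "stressed E (X ` {..<Suc d})"
  proof (rule stressed_rescale[where x = "\<lambda>i. 1 / X d $ i"])
    fix w assume "w \<in> X ` {..<Suc d}"
    then consider "w = X d" | k where "k < d" "w = X k" by (auto simp: less_Suc_eq)
    then show "(\<chi> i. 1 / X d $ i * w $ i) \<in> insert 1 ((\<lambda>k. \<chi> i. X k $ i / X d $ i) ` {..<d})"
    proof cases
      case 1
      then have "(\<chi> i. 1 / X d $ i * w $ i) = 1" using assms by (simp add: vec_eq_iff)
      then show ?thesis by simp
    next
      case 2
      then have "(\<chi> i. 1 / X d $ i * w $ i) = (\<chi> i. X k $ i / X d $ i)" by (simp add: vec_eq_iff)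
      then show ?thesis using 2 by auto
    qed
  qed (use assms in simp)
qed

lemma generic_frameworks_lift_iff:
  fixes E :: "('n::finite \<times> 'n) set"
  assumes "sym E"
  shows "generic_frameworks_lift E d \<longleftrightarrow> (\<forall>p :: 'n framework. generic_framework d p \<longrightarrow>
    \<not> stressed E (insert 1 ((\<lambda>k. \<chi> i. p i k) ` {..<d})))"
  unfolding generic_frameworks_lift_def spanning_lift_iff_not_stressed[OF assms] ..

lemma borel_measurable_PiM_entry:
  assumes "sets \<mu> = sets borel" "k \<in> J"
  shows "(\<lambda>X. X k $ i) \<in> borel_measurable (PiM J (\<lambda>_. \<mu> :: (real^'n) measure))"
proof -
  have "(\<lambda>X. X k) \<in> measurable (PiM J (\<lambda>_. \<mu>)) \<mu>" using assms(2) by (rule measurable_component_singleton)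
  moreover have "(\<lambda>v :: real^'n. v $ i) \<in> borel_measurable \<mu>"
    unfolding measurable_cong_sets[OF assms(1) refl]
    by (intro borel_measurable_continuous_onI continuous_intros)
  ultimately show ?thesis by (rule measurable_compose)
qed

text \<open>The normalized coordinates are quotients. Once the last sample is fixed they are linear
  in the others, so a nonzero polynomial in them has a null zero set; and there are only countably
  many rational polynomials.\<close>

lemma AE_normalized_generic:
  fixes \<mu> :: "(real^'n::finite) measure"
  assumes \<mu>: "lebesgue_equivalent_distribution \<mu>"
  shows "AE X in PiM {..<Suc d} (\<lambda>_. \<mu>). (\<forall>i. X d $ i \<noteq> 0) \<and>
    generic_framework d (\<lambda>i k. X k $ i / X d $ i)"
proof -
  interpret prob_space \<mu> using \<mu> by (simp add: lebesgue_equivalent_distribution_def)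
  interpret product_sigma_finite "\<lambda>_ :: nat. \<mu>" by standard
  have sets_\<mu>: "sets \<mu> = sets borel" and ac: "absolutely_continuous lborel \<mu>"
    using \<mu> by (auto simp: lebesgue_equivalent_distribution_def)
  have space_\<mu>: "space \<mu> = UNIV" using sets_eq_imp_space_eq[OF sets_\<mu>] by simp
  have thin: "thin_zero_sets \<mu>" by (rule thin_zero_sets_absolutely_continuous[OF sets_\<mu> ac])
  let ?I = "UNIV \<times> {..<d} :: ('n \<times> nat) set"
  note [measurable] = borel_measurable_PiM_entry[OF sets_\<mu>]
  have nz: "AE y in \<mu>. \<forall>i. y $ i \<noteq> 0"
  proof -
    have "AE y in \<mu>. y $ i \<noteq> 0" for i
    proof -
      have "(\<lambda>y :: real^'n. y $ i) \<in> borel_measurable \<mu>"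
        unfolding measurable_cong_sets[OF sets_\<mu> refl]
        by (intro borel_measurable_continuous_onI continuous_intros)
      moreover have "polynomial_on_lines (\<lambda>y :: real^'n. y $ i)"
        unfolding polynomial_on_lines_def
      proof (intro allI)
        fix a b :: "real^'n"
        show "\<exists>q. \<forall>t. (a + t *\<^sub>R b) $ i = poly q t" by (rule exI[of _ "[:a $ i, b $ i:]"]) simp
      qed
      moreover have "(1 :: real^'n) $ i \<noteq> 0" by simp
      ultimately show ?thesis using thin unfolding thin_zero_sets_def by blast
    qed
    then show ?thesis by (simp add: AE_all_countable countable_finite)
  qed
  have main: "AE X in PiM (insert d {..<d}) (\<lambda>_. \<mu>).
      (\<forall>i. X d $ i \<noteq> 0) \<and> eval_poly P (\<lambda>(i, k). X k $ i / X d $ i) \<noteq> 0"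
    if P: "P \<in> poly_over ?I" "P \<noteq> 0" for P
  proof (rule AE_PiM_insert)
    have [measurable]: "(\<lambda>X. eval_poly P (\<lambda>(i, k). X k $ i / X d $ i))
        \<in> borel_measurable (PiM (insert d {..<d}) (\<lambda>_. \<mu>))"
      unfolding eval_poly_def
    proof (intro borel_measurable_sum borel_measurable_times borel_measurable_const
        borel_measurable_prod borel_measurable_power)
      fix m v assume "m \<in> Poly_Mapping.keys P" "v \<in> Poly_Mapping.keys m"
      then obtain i k where "v = (i, k)" "k < d" using poly_overD[OF P(1)] by blast
      then show "(\<lambda>X. (\<lambda>(i, k). X k $ i / X d $ i) v) \<in> borel_measurable (PiM (insert d {..<d}) (\<lambda>_. \<mu>))"
        by simp
    qed
    show "{X \<in> space (PiM (insert d {..<d}) (\<lambda>_. \<mu>)). (\<forall>i. X d $ i \<noteq> 0) \<and>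
        eval_poly P (\<lambda>(i, k). X k $ i / X d $ i) \<noteq> 0} \<in> sets (PiM (insert d {..<d}) (\<lambda>_. \<mu>))"
      by measurable
    show "AE y in \<mu>. AE X in PiM {..<d} (\<lambda>_. \<mu>). (\<forall>i. (X(d := y)) d $ i \<noteq> 0) \<and>
        eval_poly P (\<lambda>(i, k). (X(d := y)) k $ i / (X(d := y)) d $ i) \<noteq> 0"
      using nz
    proof eventually_elim
      case (elim y)
      define f where "f X = eval_poly P (\<lambda>(i, k). X k $ i / y $ i)" for X :: "nat \<Rightarrow> real^'n"
      obtain z where z: "eval_poly P z \<noteq> 0" using eval_poly_nonzero[OF P(2)] by blast
      \<comment> \<open>Scaled by \<open>y\<close> so that normalization returns the point
        \<open>z\<close>, where \<open>P\<close> does not vanish.\<close>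
      define x0 :: "nat \<Rightarrow> real^'n" where "x0 = restrict (\<lambda>k. \<chi> i. z (i, k) * y $ i) {..<d}"
      have "AE X in PiM {..<d} (\<lambda>_. \<mu>). f X \<noteq> 0"
      proof (rule AE_PiM_polynomial_nonzero[where ?x0.0 = x0])
        show "f \<in> borel_measurable (PiM {..<d} (\<lambda>_. \<mu>))"
          unfolding eval_poly_def f_def
        proof (intro borel_measurable_sum borel_measurable_times borel_measurable_const
            borel_measurable_prod borel_measurable_power)
          fix m v assume "m \<in> Poly_Mapping.keys P" "v \<in> Poly_Mapping.keys m"
          then obtain i k where "v = (i, k)" "k < d" using poly_overD[OF P(1)] by blast
          then show "(\<lambda>X. (\<lambda>(i, k). X k $ i / y $ i) v) \<in> borel_measurable (PiM {..<d} (\<lambda>_. \<mu>))"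
            by simp
        qed
        have "f x0 = eval_poly P z"
          unfolding f_def using elim by (intro eval_poly_cong[OF P(1)]) (auto simp: x0_def)
        then show "f x0 \<noteq> 0" using z by simp
        fix a b :: "nat \<Rightarrow> real^'n"
        have "f (\<lambda>j. a j + t *\<^sub>R b j) = eval_poly P (\<lambda>v. (case v of (i, k) \<Rightarrow> a k $ i / y $ i)
            + t * (case v of (i, k) \<Rightarrow> b k $ i / y $ i))" for t
          unfolding f_def by (intro arg_cong[where f = "eval_poly P"]) (auto simp: add_divide_distrib)
        then show "\<exists>q. \<forall>t. f (\<lambda>j. a j + t *\<^sub>R b j) = poly q t" using eval_poly_line by simp
      qed (auto simp: thin space_\<mu> x0_def product_sigma_finite_axioms)
      then show ?case
      proof eventually_elim
        case (elim X)
        have "eval_poly P (\<lambda>(i, k). (X(d := y)) k $ i / (X(d := y)) d $ i) = f X"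
          unfolding f_def by (rule eval_poly_cong[OF P(1)]) auto
        then show ?case using elim \<open>\<forall>i. y $ i \<noteq> 0\<close> by simp
      qed
    qed
  qed (auto simp: product_sigma_finite_axioms)
  have "countable (UNIV :: (('n \<times> nat \<Rightarrow>\<^sub>0 nat) \<Rightarrow>\<^sub>0 rat) set)"
    by (intro countable_poly_mapping) (auto intro: countable_SIGMA simp flip: UNIV_Times_UNIV simp: countable_finite)
  then have "countable (poly_over ?I - {0})" by (rule countable_subset[rotated]) simp
  then have "AE X in PiM (insert d {..<d}) (\<lambda>_. \<mu>). \<forall>P\<in>poly_over ?I - {0}.
      (\<forall>i. X d $ i \<noteq> 0) \<and> eval_poly P (\<lambda>(i, k). X k $ i / X d $ i) \<noteq> 0"
    using main by (subst AE_ball_countable) auto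
  then have "AE X in PiM {..<Suc d} (\<lambda>_. \<mu>). \<forall>P\<in>poly_over ?I - {0}.
      (\<forall>i. X d $ i \<noteq> 0) \<and> eval_poly P (\<lambda>(i, k). X k $ i / X d $ i) \<noteq> 0" unfolding lessThan_Suc .
  then show ?thesis
  proof eventually_elim
    case (elim X)
    \<comment> \<open>The polynomial 1 is among those considered for every \<open>d\<close>,
      including 0; instantiating it yields the condition on \<open>X d\<close>.\<close>
    have "(1 :: ('n \<times> nat \<Rightarrow>\<^sub>0 nat) \<Rightarrow>\<^sub>0 rat) \<in> poly_over ?I - {0}" by (simp add: poly_over_def)
    then have "\<forall>i. X d $ i \<noteq> 0" using elim by blast
    moreover have "generic_framework d (\<lambda>i k. X k $ i / X d $ i)"
      unfolding generic_framework_def algebraically_independent_over_rat_def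
      using elim by (auto simp: poly_over_def)
    ultimately show ?case by blast
  qed
qed

section \<open>Almost sure existence and generic lifts\<close>

lemma generic_lift_imp_mle_exists:
  fixes E :: "('n::finite \<times> 'n) set"
  assumes "sym E" "generic_frameworks_lift E d"
  shows "mle_exists_almost_surely E (Suc d)"
  unfolding mle_exists_almost_surely_def
proof (intro allI impI)
  fix \<mu> :: "(real^'n) measure" assume "lebesgue_equivalent_distribution \<mu>"
  from AE_normalized_generic[OF this, of d] show "AE X in PiM {..<Suc d} (\<lambda>_. \<mu>). mle_exists E (Suc d) X"
  proof eventually_elim
    case (elim X)
    then have "\<not> stressed E (X ` {..<Suc d})"
      using assms(2) unfolding generic_frameworks_lift_iff[OF assms(1)]
      by (subst stressed_columns_iff) auto
    then show ?case by (simp add: mle_exists_iff_not_stressed)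
  qed
qed

text \<open>Otherwise unstressed configurations converge to \<open>Y\<close>, which is
  \<open>p\<close> with the all-ones vector as last sample. Their normalizations converge to
  \<open>p\<close>, contradicting \<open>generic_stressed_tracks\<close>.\<close>

lemma stressed_neighbourhood:
  fixes p :: "'n::finite framework"
  assumes "generic_framework d p" "stressed E (insert 1 ((\<lambda>k. \<chi> i. p i k) ` {..<d}))"
  defines "Y \<equiv> \<lambda>k. if k < d then (\<chi> i. p i k) else 1"
  shows "\<exists>e>0. \<forall>X. (\<forall>k\<le>d. \<forall>i. \<bar>X k $ i - Y k $ i\<bar> < e) \<longrightarrow> stressed E (X ` {..<Suc d})"
proof (rule ccontr)
  assume "\<not> ?thesis"
  then have "\<forall>n. \<exists>X. (\<forall>k\<le>d. \<forall>i. \<bar>X k $ i - Y k $ i\<bar> < 1 / real (Suc n)) \<and> \<not> stressed E (X ` {..<Suc d})"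
    by (auto dest: spec[of _ "1 / real (Suc n)" for n])
  then obtain X where X: "\<And>n k i. k \<le> d \<Longrightarrow> \<bar>X n k $ i - Y k $ i\<bar> < 1 / real (Suc n)"
      "\<And>n. \<not> stressed E (X n ` {..<Suc d})"
    by metis
  have lim: "(\<lambda>n. X n k $ i) \<longlonglongrightarrow> Y k $ i" if "k \<le> d" for k i
  proof (rule LIMSEQ_I)
    fix r :: real assume "r > 0"
    then obtain N where N: "1 / real (Suc N) < r" using nat_approx_posE by (metis inverse_eq_divide)
    have "norm (X n k $ i - Y k $ i) < r" if "n \<ge> N" for n
    proof -
      have "1 / real (Suc n) \<le> 1 / real (Suc N)" using that by (intro divide_left_mono) auto
      then show ?thesis using X(1)[OF \<open>k \<le> d\<close>, of n i] N by simp
    qed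
    then show "\<exists>N. \<forall>n\<ge>N. norm (X n k $ i - Y k $ i) < r" by blast
  qed
  have "(\<lambda>n. X n d $ i) \<longlonglongrightarrow> 1" for i using lim[of d i] by (simp add: Y_def)
  note one = this
  have "(\<lambda>n. X n k $ i / X n d $ i) \<longlonglongrightarrow> p i k / 1" if "k < d" for i k
    using lim[of k i] that by (intro tendsto_divide one) (auto simp: Y_def)
  then have "\<forall>\<^sub>F n in sequentially. stressed E (insert 1 ((\<lambda>k. \<chi> i. X n k $ i / X n d $ i) ` {..<d}))"
    by (intro generic_stressed_tracks[OF assms(1,2)]) simp
  moreover have "\<forall>\<^sub>F n in sequentially. \<forall>i. X n d $ i \<noteq> 0"
    by (intro eventually_all_finite tendsto_imp_eventually_ne[OF one]) simp
  ultimately have "\<forall>\<^sub>F n in sequentially. False"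
    by eventually_elim (use X(2) stressed_columns_iff in blast)
  then show False by simp
qed

text \<open>Around a stressed generic framework there is a product of balls on which the estimator
  fails to exist. Balls are not Lebesgue null, so the samples hit this product with positive
  probability.\<close>

lemma mle_exists_imp_generic_lift:
  fixes E :: "('n::finite \<times> 'n) set"
  assumes "sym E" and mle: "mle_exists_almost_surely E (Suc d)"
  shows "generic_frameworks_lift E d"
  unfolding generic_frameworks_lift_iff[OF assms(1)]
proof (intro allI impI notI)
  fix p :: "'n framework"
  assume p: "generic_framework d p" "stressed E (insert 1 ((\<lambda>k. \<chi> i. p i k) ` {..<d}))"
  define Y where "Y = (\<lambda>k. if k < d then (\<chi> i. p i k) else 1 :: real^'n)"
  obtain e where e: "e > 0"
      "\<And>X. (\<And>k i. k \<le> d \<Longrightarrow> \<bar>X k $ i - Y k $ i\<bar> < e) \<Longrightarrow> stressed E (X ` {..<Suc d})"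
    using stressed_neighbourhood[OF p] unfolding Y_def by blast
  obtain \<mu> :: "(real^'n) measure" where \<mu>: "lebesgue_equivalent_distribution \<mu>"
    using lebesgue_equivalent_distribution_exists by blast
  interpret prob_space \<mu> using \<mu> by (simp add: lebesgue_equivalent_distribution_def)
  interpret product_prob_space "\<lambda>_ :: nat. \<mu>" by standard
  have sets_\<mu>: "sets \<mu> = sets borel" and ac: "absolutely_continuous \<mu> lborel"
    using \<mu> by (auto simp: lebesgue_equivalent_distribution_def)
  define U where "U = (\<Pi>\<^sub>E k\<in>{..<Suc d}. ball (Y k) e)"
  have U: "U \<in> sets (PiM {..<Suc d} (\<lambda>_. \<mu>))" 
    unfolding U_def by (intro sets_PiM_I_finite) (auto simp: sets_\<mu>)
  have "\<not> mle_exists E (Suc d) X" if "X \<in> U" for X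
  proof -
    have "\<bar>X k $ i - Y k $ i\<bar> < e" if "k \<le> d" for k i
    proof -
      have "X k \<in> ball (Y k) e" using PiE_mem[OF \<open>X \<in> U\<close>[unfolded U_def], of k] that by simp
      then have "norm (X k - Y k) < e" by (simp add: dist_norm norm_minus_commute)
      then show ?thesis using component_le_norm_cart[of "X k - Y k" i]
        by (metis order.strict_trans1 vector_minus_component)
    qed
    then show ?thesis using e(2) by (simp add: mle_exists_iff_not_stressed)
  qed
  moreover have "AE X in PiM {..<Suc d} (\<lambda>_. \<mu>). mle_exists E (Suc d) X"
    using mle \<mu> unfolding mle_exists_almost_surely_def by blast
  moreover from this have "AE X in PiM {..<Suc d} (\<lambda>_. \<mu>). X \<notin> U"
    by eventually_elim (use calculation in blast)
  ultimately have "emeasure (PiM {..<Suc d} (\<lambda>_. \<mu>)) U = 0"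
    using AE_iff_null_sets[OF U] by (metis null_setsD1)
  moreover have "emeasure (PiM {..<Suc d} (\<lambda>_. \<mu>)) U = (\<Prod>k\<in>{..<Suc d}. emeasure \<mu> (ball (Y k) e))"
    unfolding U_def by (intro emeasure_PiM) (auto simp: sets_\<mu>)
  ultimately have "(\<Prod>k\<in>{..<Suc d}. emeasure \<mu> (ball (Y k) e)) = 0" by simp
  then obtain k where "emeasure \<mu> (ball (Y k) e) = 0" unfolding ennreal_prod_eq_0 by blast
  then have "ball (Y k) e \<in> null_sets \<mu>" by (intro null_setsI) (simp_all add: sets_\<mu>)
  then have "ball (Y k) e \<in> null_sets lborel" using ac unfolding absolutely_continuous_def by blast
  then have "measure lborel (ball (Y k) e) = 0" by (simp add: measure_def null_setsD1)
  then show False using content_ball_pos[OF e(1), of "Y k"] by simp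
qed

text \<open>Ensures that \<open>LEAST\<close> in \<open>mlt\<close> ranges over a nonempty set. The
  coordinate vectors form an invertible matrix, because the determinant is a rational polynomial
  that is not identically zero; so only the zero matrix annihilates them.\<close>

lemma generic_lift_card:
  fixes E :: "('n::finite \<times> 'n) set"
  assumes "sym E"
  shows "generic_frameworks_lift E CARD('n)"
  unfolding generic_frameworks_lift_iff[OF assms]
proof (intro allI impI notI)
  fix p :: "'n framework"
  assume gen: "generic_framework CARD('n) p"
    and "stressed E (insert 1 ((\<lambda>k. \<chi> i. p i k) ` {..<CARD('n)}))"
  then obtain \<Omega> :: "real^'n^'n" where \<Omega>: "\<Omega> \<noteq> 0" "\<And>k. k < CARD('n) \<Longrightarrow> \<Omega> *v (\<chi> i. p i k) = 0"
    unfolding stressed_def by auto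
  obtain h :: "'n \<Rightarrow> nat" where h: "bij_betw h UNIV {..<CARD('n)}"
    using ex_bij_betw_finite_nat[of "UNIV :: 'n set"] by (auto simp: atLeast0LessThan)
  then have hlt: "h j < CARD('n)" for j by (auto simp: bij_betw_def)
  define D where "D x = det (\<chi> i j. x (i, h j) :: real^'n^'n)" for x
  have "rat_polynomial (UNIV \<times> {..<CARD('n)}) D"
    unfolding D_def det_def
    by (simp, intro rat_polynomial_sum rat_polynomial_mult rat_polynomial_of_int rat_polynomial_prod
        rat_polynomial_var) (simp add: hlt)
  moreover have "D (\<lambda>(i, k). if k = h i then 1 else 0) \<noteq> 0"
  proof -
    have "(\<chi> i j. if h j = h i then 1 else 0) = (mat 1 :: real^'n^'n)"
      using h by (auto simp: vec_eq_iff mat_def bij_betw_def inj_eq)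
    then show ?thesis by (simp add: D_def)
  qed
  ultimately have "D (\<lambda>(i, k). p i k) \<noteq> 0"
    using algebraically_independent_rat_polynomial[OF gen[unfolded generic_framework_def]] by metis
  then have "invertible (\<chi> i j. p i (h j) :: real^'n^'n)" by (simp add: D_def invertible_det_nz)
  then obtain B where B: "(\<chi> i j. p i (h j)) ** B = mat 1" by (auto simp: invertible_def)
  have "\<Omega> ** (\<chi> i j. p i (h j)) = 0"
    using \<Omega>(2)[OF hlt] by (simp add: matrix_matrix_mult_def matrix_vector_mult_def vec_eq_iff)
  then have "\<Omega> ** ((\<chi> i j. p i (h j)) ** B) = 0" by (simp add: matrix_mul_assoc)
  then show False using B \<Omega>(1) by simp
qed

theorem mle_exists_almost_surely_iff:
  "sym E \<Longrightarrow> mle_exists_almost_surely E (Suc d) \<longleftrightarrow> generic_frameworks_lift E d"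
  using generic_lift_imp_mle_exists mle_exists_imp_generic_lift by blast

theorem mainTheorem2:
  fixes E :: "('n::finite \<times> 'n) set" and d :: nat
  assumes "sym E" and "irrefl E"
  shows "mlt E = d + 1 \<longleftrightarrow>
    generic_frameworks_lift E d \<and> (\<forall>d'<d. \<not> generic_frameworks_lift E d')"
proof -
  \<comment> \<open>\<open>N\<close> samples correspond to dimension \<open>N - 1\<close>; the
    condition \<open>1 \<le> N\<close> excludes \<open>N = 0\<close>, to which no dimension
    corresponds.\<close>
  let ?P = "\<lambda>N. 1 \<le> N \<and> mle_exists_almost_surely E N"
  have P_Suc: "?P (Suc k) \<longleftrightarrow> generic_frameworks_lift E k" for k
    using mle_exists_almost_surely_iff[OF assms(1)] by simp
  have ex: "?P (Suc CARD('n))" using generic_lift_card[OF assms(1)] P_Suc by blast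
  show ?thesis
  proof
    assume "mlt E = d + 1"
    then have eq: "(LEAST N. ?P N) = Suc d" by (simp add: mlt_def)
    then have "?P (Suc d)" using LeastI[of ?P, OF ex] by simp
    moreover have "\<not> ?P (Suc k)" if "k < d" for k
      using not_less_Least[of "Suc k" ?P] eq that by simp
    ultimately show "generic_frameworks_lift E d \<and> (\<forall>d'<d. \<not> generic_frameworks_lift E d')"
      using P_Suc by blast
  next
    assume lift: "generic_frameworks_lift E d \<and> (\<forall>d'<d. \<not> generic_frameworks_lift E d')"
    have "(LEAST N. ?P N) = Suc d"
    proof (rule Least_equality)
      show "?P (Suc d)" using lift P_Suc by blast
      fix N assume N: "?P N"
      then obtain k where "N = Suc k" by (cases N) auto
      then show "Suc d \<le> N" using N P_Suc[of k] lift by (metis Suc_le_mono not_le)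
    qed
    then show "mlt E = d + 1" by (simp add: mlt_def)
  qed
qed

end
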